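(* Let $\mathcal{X}=\{1,2,\ldots,|\mathcal{X}|\}$ be a finite set, let $\mathcal{H}$ be a separable Hilbert space, and let $W:\mathcal{X}\to\mathcal{S}(\mathcal{H})$, $x\mapsto W_x$, be a classical-quantum channel. Let $P$ be a probability distribution on $\mathcal{X}$. Then the function $$s\mapsto E_0(s,P) = -\log \operatorname{Tr}\left[\left(\sum_{x\in\mathcal{X}} P(x)\, W_x^{\frac{1}{1+s}}\right)^{1+s}\right]$$ is concave on $s\in[0,\infty)$.
   Context: $\mathcal{S}(\mathcal{H})$ denotes the set of density operators on $\mathcal{H}$, i.e. positive semi-definite operators with unit trace. A classical-quantum channel is an arbitrary map $W:\mathcal{X}\to\mathcal{S}(\mathcal{H})$, $x\mapsto W_x$; the operators $W_x$ need not commute and need not be invertible. Powers of positive semi-definite operators are taken by functional calculus (with $0^p=0$ for $p>0$). The logarithm is with respect to a fixed base greater than $1$. The function $E_0(s,P)$ is called the auxiliary function of the channel $W$ with input distribution $P$. *)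

theory Defs
  imports "HOL-Probability.Probability"
begin

section \<open>Complex Hilbert spaces\<close>

text \<open>
  A complex inner product space is a real one with a complex scalar multiplication and a
  sesquilinear form \<open>cinner\<close> (conjugate linear in the first argument) whose real part is the
  real inner product. Definiteness, norm and topology are thus those of \<open>real_inner\<close>.
\<close>

class complex_inner = real_inner +
  fixes scaleC :: "complex \<Rightarrow> 'a \<Rightarrow> 'a"  (infixr \<open>*\<^sub>C\<close> 75)
    and cinner :: "'a \<Rightarrow> 'a \<Rightarrow> complex"
  assumes scaleC_add_right: "c *\<^sub>C (x + y) = c *\<^sub>C x + c *\<^sub>C y"
    and scaleC_add_left: "(c + d) *\<^sub>C x = c *\<^sub>C x + d *\<^sub>C x"
    and scaleC_scaleC: "c *\<^sub>C d *\<^sub>C x = (c * d) *\<^sub>C x"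
    and scaleC_of_real: "complex_of_real r *\<^sub>C x = r *\<^sub>R x"
    and cinner_commute: "cinner x y = cnj (cinner y x)"
    and cinner_add_right: "cinner x (y + z) = cinner x y + cinner x z"
    and cinner_scaleC_right: "cinner x (c *\<^sub>C y) = c * cinner x y"
    and Re_cinner: "Re (cinner x y) = inner x y"

class complex_hilbert = complex_inner + complete_space

instantiation complex :: complex_hilbert
begin

definition scaleC_complex :: "complex \<Rightarrow> complex \<Rightarrow> complex"
  where "scaleC_complex c x = c * x"

definition cinner_complex :: "complex \<Rightarrow> complex \<Rightarrow> complex"
  where "cinner_complex x y = cnj x * y"

instance
  by standard
    (simp_all add: scaleC_complex_def cinner_complex_def algebra_simps scaleR_conv_of_real
      inner_complex_def)

end

abbreviation cspan :: "'a::complex_inner set \<Rightarrow> 'a set"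
  where "cspan \<equiv> module.span scaleC"

lemma vector_space_scaleC: "vector_space (scaleC :: complex \<Rightarrow> 'a \<Rightarrow> 'a::complex_inner)"
proof
  show "1 *\<^sub>C x = x" for x :: 'a
    using scaleC_of_real[of 1 x] by simp
qed (simp_all add: scaleC_add_right scaleC_add_left scaleC_scaleC)

definition orthonormal_basis :: "'a::complex_inner set \<Rightarrow> bool"
  where "orthonormal_basis B \<longleftrightarrow>
    (\<forall>e\<in>B. \<forall>f\<in>B. cinner e f = (if e = f then 1 else 0)) \<and> closure (cspan B) = UNIV"


section \<open>Bounded operators\<close>

text \<open>
  The type \<open>'a \<Rightarrow>\<^sub>L 'a\<close> consists of the bounded \<^emph>\<open>real\<close>-linear maps (with the operator norm);
  the bounded operators of the complex Hilbert space are those satisfying \<open>complex_linear\<close>.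
\<close>

definition complex_linear :: "('a::complex_inner \<Rightarrow>\<^sub>L 'a) \<Rightarrow> bool"
  where "complex_linear T \<longleftrightarrow> (\<forall>c x. blinfun_apply T (c *\<^sub>C x) = c *\<^sub>C blinfun_apply T x)"

definition positive_operator :: "('a::complex_inner \<Rightarrow>\<^sub>L 'a) \<Rightarrow> bool"
  where "positive_operator T \<longleftrightarrow>
    complex_linear T \<and> (\<forall>x. cinner x (blinfun_apply T x) \<in> \<real>\<^sub>\<ge>\<^sub>0)"

text \<open>
  For positive operators the choice of the orthonormal basis is immaterial. If the diagonal is
  not summable, \<^const>\<open>infsum\<close> returns 0, so a positive operator of trace 1 is trace class.
\<close>

definition op_trace :: "('a::complex_hilbert \<Rightarrow>\<^sub>L 'a) \<Rightarrow> complex"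
  where "op_trace T = (\<Sum>\<^sub>\<infinity>e\<in>(SOME B. orthonormal_basis B). cinner e (blinfun_apply T e))"

definition density_operator :: "('a::complex_hilbert \<Rightarrow>\<^sub>L 'a) \<Rightarrow> bool"
  where "density_operator T \<longleftrightarrow> positive_operator T \<and> op_trace T = 1"


section \<open>Continuous functional calculus\<close>

definition spectrum :: "('a::complex_hilbert \<Rightarrow>\<^sub>L 'a) \<Rightarrow> complex set"
  where "spectrum T = {z. \<nexists>S :: 'a \<Rightarrow>\<^sub>L 'a. complex_linear S \<and>
    (\<forall>x. blinfun_apply S (blinfun_apply T x - z *\<^sub>C x) = x) \<and>
    (\<forall>x. blinfun_apply T (blinfun_apply S x) - z *\<^sub>C blinfun_apply S x = x)}"

definition op_poly :: "real poly \<Rightarrow> ('a::complex_hilbert \<Rightarrow>\<^sub>L 'a) \<Rightarrow> ('a \<Rightarrow>\<^sub>L 'a)"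
  where "op_poly p T =
    (\<Sum>i\<le>degree p. coeff p i *\<^sub>R (((\<lambda>S. T o\<^sub>L S) ^^ i) id_blinfun))"

text \<open>
  For self-adjoint \<open>T\<close> (whose spectrum is real) and \<open>f\<close> continuous on the spectrum, \<open>f(T)\<close> is
  the limit in operator norm of \<open>p\<^sub>n(T)\<close>, for any real polynomials \<open>p\<^sub>n\<close> converging to \<open>f\<close>
  uniformly on the spectrum of \<open>T\<close>. For other \<open>T\<close> and \<open>f\<close> the value is not meaningful.
\<close>

definition functional_calculus ::
    "(real \<Rightarrow> real) \<Rightarrow> ('a::complex_hilbert \<Rightarrow>\<^sub>L 'a) \<Rightarrow> ('a \<Rightarrow>\<^sub>L 'a)"
  where "functional_calculus f T = (THE S. \<forall>p :: nat \<Rightarrow> real poly.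
    uniform_limit {t. complex_of_real t \<in> spectrum T} (\<lambda>n. poly (p n)) f sequentially \<longrightarrow>
    (\<lambda>n. op_poly (p n) T) \<longlonglongrightarrow> S)"

text \<open>Note that \<open>0 powr r = 0\<close>.\<close>

definition op_powr :: "('a::complex_hilbert \<Rightarrow>\<^sub>L 'a) \<Rightarrow> real \<Rightarrow> ('a \<Rightarrow>\<^sub>L 'a)"
  where "op_powr T r = functional_calculus (\<lambda>t. t powr r) T"


section \<open>Classical-quantum channels\<close>

definition cq_channel :: "'x set \<Rightarrow> ('x \<Rightarrow> ('a::complex_hilbert \<Rightarrow>\<^sub>L 'a)) \<Rightarrow> bool"
  where "cq_channel X W \<longleftrightarrow> (\<forall>x\<in>X. density_operator (W x))"

text \<open>
  The trace below is a nonnegative real number; \<^const>\<open>Re\<close> only adjusts the type. The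
  parameter \<open>b\<close> is the base of the logarithm.
\<close>

definition auxiliary_function ::
    "real \<Rightarrow> 'x set \<Rightarrow> ('x \<Rightarrow> ('a::complex_hilbert \<Rightarrow>\<^sub>L 'a)) \<Rightarrow> real \<Rightarrow> 'x pmf \<Rightarrow> real"
  where "auxiliary_function b X W s P =
    - log b (Re (op_trace (op_powr (\<Sum>x\<in>X. pmf P x *\<^sub>R op_powr (W x) (1 / (1 + s))) (1 + s))))"

end

theory Submission
  imports Defs
begin

text \<open>
  Put \<open>A\<^sub>p = \<Sum>\<^sub>x P(x) W\<^sub>x\<^bsup>1/p\<^esup>\<close> and \<open>F(p) = Tr A\<^sub>p\<^sup>p\<close>; the claim is log-convexity of \<open>F\<close> on \<open>[1,\<infinity>)\<close>.
  Let \<open>p = t p\<^sub>0 + (1 - t) p\<^sub>1\<close> and \<open>l = t p\<^sub>0 / p\<close>, so that \<open>1/p = l/p\<^sub>0 + (1 - l)/p\<^sub>1\<close>. Hoelder's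
  inequality for the spectral measures of the \<open>W\<^sub>x\<close> and then for the sum over \<open>x\<close> gives
  \<open>\<langle>e, A\<^sub>p e\<rangle> \<le> \<langle>e, A\<^bsub>p\<^sub>0\<^esub> e\<rangle>\<^sup>l \<langle>e, A\<^bsub>p\<^sub>1\<^esub> e\<rangle>\<^bsup>1-l\<^esup>\<close> for every vector \<open>e\<close>. Now let \<open>e\<close> run through an
  orthonormal eigenbasis of the compact operator \<open>A\<^sub>p\<close>, raise to the power \<open>p\<close>, sum, and use Hoelder
  once more: \<open>F(p) \<le> (\<Sum>\<^sub>e \<langle>e, A\<^bsub>p\<^sub>0\<^esub> e\<rangle>\<^bsup>p\<^sub>0\<^esup>)\<^sup>t (\<Sum>\<^sub>e \<langle>e, A\<^bsub>p\<^sub>1\<^esub> e\<rangle>\<^bsup>p\<^sub>1\<^esup>)\<^bsup>1-t\<^esup>\<close>. By Jensen's inequality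
  \<open>\<langle>e, A e\<rangle>\<^sup>p \<le> \<langle>e, A\<^sup>p e\<rangle>\<close> for unit vectors and \<open>p \<ge> 1\<close>, so the right-hand side is at most
  \<open>F(p\<^sub>0)\<^sup>t F(p\<^sub>1)\<^bsup>1-t\<^esup>\<close>. The same Jensen argument yields \<open>F \<le> 1\<close>, hence all traces are finite.
\<close>

section \<open>Complex inner products\<close>

interpretation cvs: vector_space "scaleC :: complex \<Rightarrow> 'a \<Rightarrow> 'a::complex_inner"
  by (rule vector_space_scaleC)

lemma cinner_add_left: "cinner (x + y) z = cinner x z + cinner y z"
  by (metis cinner_commute cinner_add_right complex_cnj_add)

lemma cinner_scaleC_left: "cinner (c *\<^sub>C x) y = cnj c * cinner x y"
  by (metis cinner_commute cinner_scaleC_right complex_cnj_mult)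

lemma cinner_scaleR_right: "cinner x (r *\<^sub>R y) = of_real r * cinner x y"
  by (metis cinner_scaleC_right scaleC_of_real)

lemma cinner_scaleR_left: "cinner (r *\<^sub>R x) y = of_real r * cinner x y"
  by (metis cinner_scaleC_left scaleC_of_real complex_cnj_complex_of_real)

lemma cinner_zero_right [simp]: "cinner x 0 = 0"
  using cinner_scaleR_right[of x 0 0] by simp

lemma cinner_zero_left [simp]: "cinner 0 x = 0"
  using cinner_scaleR_left[of 0 0 x] by simp

lemma cinner_minus_right: "cinner x (- y) = - cinner x y"
  using cinner_scaleR_right[of x "-1" y] by simp

lemma cinner_diff_right: "cinner x (y - z) = cinner x y - cinner x z"
  using cinner_add_right[of x y "- z"] by (simp add: cinner_minus_right)

lemma cinner_sum_right: "cinner x (\<Sum>i\<in>A. f i) = (\<Sum>i\<in>A. cinner x (f i))"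
  by (induction A rule: infinite_finite_induct) (auto simp: cinner_add_right)

lemma cinner_sum_left: "cinner (\<Sum>i\<in>A. f i) x = (\<Sum>i\<in>A. cinner (f i) x)"
  by (induction A rule: infinite_finite_induct) (auto simp: cinner_add_left)

lemma cinner_self: "cinner x x = of_real ((norm x)\<^sup>2)"
proof -
  have "Im (cinner x x) = 0"
    using arg_cong[OF cinner_commute[of x x], of Im] by simp
  then show ?thesis
    by (simp add: complex_eq_iff Re_cinner power2_norm_eq_inner)
qed

lemma norm_scaleC: "norm (c *\<^sub>C x) = cmod c * norm x"
proof -
  have "complex_of_real ((norm (c *\<^sub>C x))\<^sup>2) = of_real ((cmod c * norm x)\<^sup>2)"
    unfolding cinner_self[symmetric] cinner_scaleC_left cinner_scaleC_right power_mult_distrib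
    unfolding cinner_self of_real_mult complex_norm_square[of c] by (simp add: ac_simps)
  then show ?thesis
    by (metis of_real_eq_iff norm_ge_zero power2_eq_imp_eq mult_nonneg_nonneg)
qed

lemma norm_cinner_le: "cmod (cinner x y) \<le> norm x * norm y"
proof (cases "cinner x y = 0")
  case False
  \<comment> \<open>The phase \<open>u\<close> rotates \<open>cinner x y\<close> onto the positive
    real axis, so the bound reduces to the real Cauchy-Schwarz inequality.\<close>
  define u where "u = cnj (cinner x y) / of_real (cmod (cinner x y))"
  have "u * cinner x y = of_real ((cmod (cinner x y))\<^sup>2) / of_real (cmod (cinner x y))"
    unfolding complex_norm_square u_def by simp
  then have "u * cinner x y = of_real (cmod (cinner x y))"
    by (simp add: power2_eq_square)
  then have "of_real (cmod (cinner x y)) = cinner x (u *\<^sub>C y)"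
    by (simp add: cinner_scaleC_right)
  then have "cmod (cinner x y) = inner x (u *\<^sub>C y)"
    by (metis Re_cinner Re_complex_of_real)
  also have "\<dots> \<le> norm x * norm (u *\<^sub>C y)"
    by (rule norm_cauchy_schwarz)
  also have "norm (u *\<^sub>C y) = norm y"
    using False by (simp add: norm_scaleC u_def norm_divide)
  finally show ?thesis .
qed simp

lemma bounded_linear_cinner_right: "bounded_linear (cinner x)"
  by (rule bounded_linear_intro[of _ "norm x"])
     (auto simp: cinner_add_right cinner_scaleR_right scaleR_conv_of_real mult.commute[of _ "norm x"]
        intro: norm_cinner_le)

lemma bounded_linear_scaleC_left: "bounded_linear (\<lambda>c. c *\<^sub>C x)"
  by (rule bounded_linear_intro[of _ "norm x"])
     (auto simp: scaleC_add_left norm_scaleC scaleR_conv_of_real scaleC_scaleC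
        simp flip: scaleC_of_real)

section \<open>Orthonormal families\<close>

text \<open>Split off from \<open>orthonormal_basis\<close> because finite subfamilies and the
  families in the Zorn argument are not known to be total.\<close>

definition orthonormal :: "'a::complex_inner set \<Rightarrow> bool"
  where "orthonormal B \<longleftrightarrow> (\<forall>e\<in>B. \<forall>f\<in>B. cinner e f = (if e = f then 1 else 0))"

lemma orthonormal_subset: "orthonormal B \<Longrightarrow> A \<subseteq> B \<Longrightarrow> orthonormal A"
  unfolding orthonormal_def by blast

lemma orthonormal_basis_imp_orthonormal: "orthonormal_basis B \<Longrightarrow> orthonormal B"
  unfolding orthonormal_def orthonormal_basis_def by blast

lemma orthonormal_norm: "orthonormal B \<Longrightarrow> e \<in> B \<Longrightarrow> norm e = 1"
  using cinner_self[of e] norm_ge_zero[of e]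
  by (auto simp: orthonormal_def power2_eq_1_iff simp flip: of_real_power)

lemma cinner_orthonormal_sum:
  assumes "orthonormal B" "finite S" "S \<subseteq> B" "f \<in> B"
  shows "cinner f (\<Sum>e\<in>S. c e *\<^sub>C e) = (if f \<in> S then c f else 0)"
proof -
  have "cinner f (\<Sum>e\<in>S. c e *\<^sub>C e) = (\<Sum>e\<in>S. if e = f then c f else 0)"
    unfolding cinner_sum_right cinner_scaleC_right
    using assms unfolding orthonormal_def by (intro sum.cong) auto
  then show ?thesis
    using assms by simp
qed

lemma norm_orthonormal_sum:
  assumes "orthonormal S" "finite S"
  shows "(norm (\<Sum>e\<in>S. c e *\<^sub>C e))\<^sup>2 = (\<Sum>e\<in>S. (cmod (c e))\<^sup>2)"
proof -
  have "complex_of_real ((norm (\<Sum>e\<in>S. c e *\<^sub>C e))\<^sup>2)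
      = (\<Sum>f\<in>S. cnj (c f) * cinner f (\<Sum>e\<in>S. c e *\<^sub>C e))"
    unfolding cinner_self[symmetric] cinner_sum_left cinner_scaleC_left ..
  also have "\<dots> = (\<Sum>f\<in>S. of_real ((cmod (c f))\<^sup>2))"
    using assms
    unfolding complex_norm_square
    by (intro sum.cong refl)
       (simp add: cinner_orthonormal_sum[OF assms(1,2) order_refl] mult.commute)
  finally show ?thesis
    unfolding of_real_sum[symmetric] of_real_eq_iff .
qed

lemma norm_Pythagoras:
  assumes "cinner x y = 0"
  shows "(norm (x + y))\<^sup>2 = (norm x)\<^sup>2 + (norm y)\<^sup>2"
proof -
  have "inner x y = 0"
    using Re_cinner[of x y] assms by simp
  then show ?thesis
    by (simp add: power2_norm_eq_inner inner_add_left inner_add_right inner_commute)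
qed

section \<open>Orthogonal projection onto the span of a finite orthonormal family\<close>

lemma orthonormal_residual:
  assumes "orthonormal S" "finite S" "f \<in> S"
  shows "cinner f (x - (\<Sum>e\<in>S. cinner e x *\<^sub>C e)) = 0"
  using cinner_orthonormal_sum[OF assms(1,2) order_refl assms(3)] assms(3)
  by (simp add: cinner_diff_right)

lemma orthonormal_residual_norm:
  assumes "orthonormal S" "finite S"
  shows "(norm x)\<^sup>2 = (norm (x - (\<Sum>e\<in>S. cinner e x *\<^sub>C e)))\<^sup>2 + (\<Sum>e\<in>S. (cmod (cinner e x))\<^sup>2)"
proof -
  let ?P = "\<Sum>e\<in>S. cinner e x *\<^sub>C e"
  have "cinner ?P (x - ?P) = 0"
    unfolding cinner_sum_left cinner_scaleC_left
    by (intro sum.neutral ballI) (simp add: orthonormal_residual assms)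
  then have "(norm (?P + (x - ?P)))\<^sup>2 = (norm ?P)\<^sup>2 + (norm (x - ?P))\<^sup>2"
    by (rule norm_Pythagoras)
  then show ?thesis
    using norm_orthonormal_sum[OF assms, of "\<lambda>e. cinner e x"] by simp
qed

lemma Bessel_finite:
  assumes "orthonormal S" "finite S"
  shows "(\<Sum>e\<in>S. (cmod (cinner e x))\<^sup>2) \<le> (norm x)\<^sup>2"
  using orthonormal_residual_norm[OF assms, of x] by simp

lemma Bessel_summable:
  assumes "orthonormal B"
  shows "(\<lambda>e. (cmod (cinner e x))\<^sup>2) summable_on B"
proof (rule nonneg_bdd_above_summable_on)
  show "bdd_above (sum (\<lambda>e. (cmod (cinner e x))\<^sup>2) ` {F. F \<subseteq> B \<and> finite F})"
    using Bessel_finite orthonormal_subset[OF assms] by (intro bdd_aboveI2[of _ _ "(norm x)\<^sup>2"]) auto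
qed auto

text \<open>The residual of the projection is orthogonal to the whole span, so by Pythagoras passing
  from the projection to \<open>v\<close> cannot decrease the distance.\<close>

lemma orthonormal_best_approx:
  assumes "orthonormal S" "finite S" "v \<in> cspan S"
  shows "norm (x - (\<Sum>e\<in>S. cinner e x *\<^sub>C e)) \<le> norm (x - v)"
proof -
  let ?P = "\<Sum>e\<in>S. cinner e x *\<^sub>C e"
  have "?P - v \<in> cspan S"
    by (intro cvs.span_diff cvs.span_sum cvs.span_scale cvs.span_base assms)
  then obtain c where c: "?P - v = (\<Sum>e\<in>S. c e *\<^sub>C e)"
    unfolding cvs.span_finite[OF assms(2)] by auto
  have "cinner (?P - v) (x - ?P) = 0"
    unfolding c cinner_sum_left cinner_scaleC_left
    by (intro sum.neutral ballI) (simp add: orthonormal_residual assms)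
  then have "(norm ((?P - v) + (x - ?P)))\<^sup>2 = (norm (?P - v))\<^sup>2 + (norm (x - ?P))\<^sup>2"
    by (rule norm_Pythagoras)
  then have "(norm (x - ?P))\<^sup>2 \<le> (norm (x - v))\<^sup>2"
    by (simp add: algebra_simps)
  then show ?thesis
    by (rule power2_le_imp_le) simp
qed

text \<open>Density puts some \<open>v\<close> from the span of a finite \<open>S\<close> close to
  \<open>x\<close>. For every finite \<open>Y\<close> containing \<open>S\<close> the partial sum
  over \<open>Y\<close> is the best approximation from a span that contains \<open>v\<close>, hence
  at least as close.\<close>

lemma orthonormal_basis_has_sum:
  assumes "orthonormal_basis B"
  shows "((\<lambda>e. cinner e x *\<^sub>C e) has_sum x) B"
proof -
  have B: "orthonormal B"
    by (rule orthonormal_basis_imp_orthonormal[OF assms])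
  have "x \<in> closure (cspan B)"
    using assms by (simp add: orthonormal_basis_def)
  show ?thesis
    unfolding has_sum_def tendsto_iff eventually_finite_subsets_at_top
  proof (intro allI impI)
    fix r :: real
    assume "r > 0"
    then obtain v where v: "v \<in> cspan B" "dist v x < r"
      using \<open>x \<in> closure (cspan B)\<close> unfolding closure_approachable by blast
    obtain S where S: "finite S" "S \<subseteq> B" "v \<in> cspan S"
      using v(1) unfolding cvs.span_explicit by (auto intro!: cvs.span_sum cvs.span_scale cvs.span_base)
    have "dist (\<Sum>e\<in>Y. cinner e x *\<^sub>C e) x < r" if Y: "finite Y" "S \<subseteq> Y" "Y \<subseteq> B" for Y
    proof -
      have "v \<in> cspan Y"
        using S(3) cvs.span_mono[OF Y(2)] by blast
      from orthonormal_best_approx[OF orthonormal_subset[OF B Y(3)] Y(1) this, of x] v(2)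
      show ?thesis
        by (simp add: dist_norm norm_minus_commute)
    qed
    with S show "\<exists>X. finite X \<and> X \<subseteq> B \<and> (\<forall>Y. finite Y \<and> X \<subseteq> Y \<and> Y \<subseteq> B \<longrightarrow>
        dist (\<Sum>e\<in>Y. cinner e x *\<^sub>C e) x < r)"
      by blast
  qed
qed

lemma orthonormal_basis_eqI:
  assumes "orthonormal_basis B" "\<And>e. e \<in> B \<Longrightarrow> cinner e x = cinner e y"
  shows "x = y"
proof -
  have "((\<lambda>e. cinner e x *\<^sub>C e) has_sum y) B"
    using orthonormal_basis_has_sum[OF assms(1), of y] assms(2) by (simp cong: has_sum_cong)
  then show ?thesis
    using orthonormal_basis_has_sum[OF assms(1), of x] has_sum_unique by blast
qed

lemma Parseval:
  assumes "orthonormal_basis B"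
  shows "((\<lambda>e. (cmod (cinner e x))\<^sup>2) has_sum (norm x)\<^sup>2) B"
proof -
  have "((\<lambda>S. (norm (\<Sum>e\<in>S. cinner e x *\<^sub>C e))\<^sup>2) \<longlongrightarrow> (norm x)\<^sup>2) (finite_subsets_at_top B)"
    using orthonormal_basis_has_sum[OF assms, of x] unfolding has_sum_def
    by (intro tendsto_intros)
  moreover have "\<forall>\<^sub>F S in finite_subsets_at_top B.
      (norm (\<Sum>e\<in>S. cinner e x *\<^sub>C e))\<^sup>2 = (\<Sum>e\<in>S. (cmod (cinner e x))\<^sup>2)"
    by (intro eventually_finite_subsets_at_top_weakI norm_orthonormal_sum
        orthonormal_subset[OF orthonormal_basis_imp_orthonormal[OF assms]])
  ultimately show ?thesis
    unfolding has_sum_def by (simp add: tendsto_cong)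
qed

text \<open>Completeness enters here. The family may be uncountable, so the net of finite partial
  sums is thinned to an increasing sequence \<open>T n\<close> with small tails, along which the
  partial sums are Cauchy.\<close>

lemma Riesz_Fischer:
  fixes B :: "'a::complex_hilbert set"
  assumes B: "orthonormal B" and c: "(\<lambda>e. (cmod (c e))\<^sup>2) summable_on B"
  obtains y where "y \<in> closure (cspan B)" "\<And>e. e \<in> B \<Longrightarrow> cinner e y = c e"
proof -
  define q where "q S = (\<Sum>e\<in>S. (cmod (c e))\<^sup>2)" for S
  define u where "u S = (\<Sum>e\<in>S. c e *\<^sub>C e)" for S
  obtain s where "(q \<longlongrightarrow> s) (finite_subsets_at_top B)"
    using c unfolding summable_on_def has_sum_def q_def by blast
  then have "\<exists>X. finite X \<and> X \<subseteq> B \<and> (\<forall>Y. finite Y \<and> X \<subseteq> Y \<and> Y \<subseteq> B \<longrightarrow> dist (q Y) s < inverse (Suc n))"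
    for n
    unfolding tendsto_iff eventually_finite_subsets_at_top by simp
  then obtain X where X: "\<And>n. finite (X n)" "\<And>n. X n \<subseteq> B"
    "\<And>n Y. finite Y \<Longrightarrow> X n \<subseteq> Y \<Longrightarrow> Y \<subseteq> B \<Longrightarrow> dist (q Y) s < inverse (Suc n)"
    by metis
  define T where "T n = (\<Union>k\<le>n. X k)" for n
  have T: "finite (T n)" "T n \<subseteq> B" "X n \<subseteq> T n" for n
    using X by (auto simp: T_def)
  have T_mono: "T n \<subseteq> T m" if "n \<le> m" for n m
    using that unfolding T_def by fastforce
  \<comment> \<open>Both \<open>q Y\<close> and \<open>q (T n)\<close> lie within
    \<open>inverse (Suc n)\<close> of the limit \<open>s\<close>, hence the factor 2.\<close>
  have tail: "q (Y - T n) < 2 * inverse (Suc n)" if "finite Y" "T n \<subseteq> Y" "Y \<subseteq> B" for n Y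
  proof -
    have "q (Y - T n) = q Y - q (T n)"
      unfolding q_def using that by (intro sum_diff)
    then show ?thesis
      using X(3)[of Y n] X(3)[of "T n" n] T[of n] that by (force simp: dist_real_def)
  qed
  have diff: "(norm (u Y - u (T n)))\<^sup>2 < 2 * inverse (Suc n)" if "finite Y" "T n \<subseteq> Y" "Y \<subseteq> B" for n Y
  proof -
    have "u Y - u (T n) = u (Y - T n)"
      unfolding u_def using that by (intro sum_diff[symmetric])
    moreover have "(norm (u (Y - T n)))\<^sup>2 = q (Y - T n)"
      unfolding u_def q_def using that
      by (intro norm_orthonormal_sum orthonormal_subset[OF B]) auto
    ultimately show ?thesis
      using tail[OF that] by simp
  qed
  have lim0: "(\<lambda>n. sqrt (2 * inverse (Suc n))) \<longlonglongrightarrow> 0"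
    using tendsto_real_sqrt[OF tendsto_mult_right_zero[OF LIMSEQ_inverse_real_of_nat, of 2]] by simp
  have "Cauchy (\<lambda>n. u (T n))"
  proof (rule metric_CauchyI)
    fix r :: real
    assume "r > 0"
    then have "\<forall>\<^sub>F n in sequentially. sqrt (2 * inverse (Suc n)) < r / 2"
      using lim0 by (intro order_tendstoD) auto
    then obtain M where M: "sqrt (2 * inverse (Suc M)) < r / 2"
      by (auto simp: eventually_sequentially)
    have "norm (u (T n) - u (T M)) < r / 2" if "n \<ge> M" for n
      using real_less_rsqrt[OF diff[OF T(1) T_mono[OF that] T(2)]] M by linarith
    then have "dist (u (T m)) (u (T n)) < r" if "m \<ge> M" "n \<ge> M" for m n
      using that dist_triangle_half_l[of "u (T m)" "u (T M)" r "u (T n)"] by (simp add: dist_norm)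
    then show "\<exists>M. \<forall>m\<ge>M. \<forall>n\<ge>M. dist (u (T m)) (u (T n)) < r"
      by blast
  qed
  then obtain y where y: "(\<lambda>n. u (T n)) \<longlonglongrightarrow> y"
    using Cauchy_convergent_iff convergent_def by blast
  have "u (T n) \<in> cspan B" for n
    unfolding u_def using T by (intro cvs.span_sum cvs.span_scale cvs.span_base) blast
  then have "y \<in> closure (cspan B)"
    using y unfolding closure_sequential by (intro exI[of _ "\<lambda>n. u (T n)"]) simp
  moreover have "cinner e y = c e" if e: "e \<in> B" for e
  proof -
    have coeff: "cinner e (u (T n)) = (if e \<in> T n then c e else 0)" for n
      unfolding u_def by (rule cinner_orthonormal_sum[OF B T(1,2) e])
    have "cmod (cinner e (u (T n)) - c e) \<le> sqrt (2 * inverse (Suc n))" for n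
    proof (cases "e \<in> T n")
      case False
      \<comment> \<open>The sets \<open>T n\<close> may miss \<open>e\<close> altogether; the tail
        bound for this one extra index then forces \<open>c e\<close> to be small.\<close>
      have "insert e (T n) - T n = {e}"
        using False by blast
      then have "(cmod (c e))\<^sup>2 < 2 * inverse (Suc n)"
        using tail[of "insert e (T n)" n] T[of n] e by (auto simp: q_def)
      then have "cmod (c e) < sqrt (2 * inverse (Suc n))"
        by (rule real_less_rsqrt)
      then show ?thesis
        using False coeff[of n] by simp
    qed (simp add: coeff)
    then have "(\<lambda>n. cinner e (u (T n)) - c e) \<longlonglongrightarrow> 0"
      by (intro Lim_null_comparison[OF _ lim0] always_eventually allI)
    then have "(\<lambda>n. cinner e (u (T n))) \<longlonglongrightarrow> c e"
      by (rule LIM_zero_cancel)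
    moreover have "(\<lambda>n. cinner e (u (T n))) \<longlonglongrightarrow> cinner e y"
      by (rule bounded_linear.tendsto[OF bounded_linear_cinner_right y])
    ultimately show ?thesis
      using LIMSEQ_unique by blast
  qed
  ultimately show ?thesis
    using that by blast
qed

text \<open>Riesz-Fischer yields a point of the closed span with the same coefficients as
  \<open>x\<close>; the difference is orthogonal to \<open>B\<close> and so vanishes. This is the
  form in which totality of a maximal family of eigenvectors is available.\<close>

lemma orthonormal_basisI:
  fixes B :: "'a::complex_hilbert set"
  assumes "orthonormal B" and "\<And>x. (\<And>e. e \<in> B \<Longrightarrow> cinner e x = 0) \<Longrightarrow> x = 0"
  shows "orthonormal_basis B"
proof -
  have "x \<in> closure (cspan B)" for x
  proof -
    obtain y where y: "y \<in> closure (cspan B)" "\<And>e. e \<in> B \<Longrightarrow> cinner e y = cinner e x"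
      using Riesz_Fischer[OF assms(1) Bessel_summable[OF assms(1), of x]] by blast
    have "x - y = 0"
      by (rule assms(2)) (simp add: cinner_diff_right y(2))
    with y(1) show ?thesis
      by simp
  qed
  then show ?thesis
    using assms(1) by (auto simp: orthonormal_basis_def orthonormal_def)
qed

section \<open>Diagonal operators\<close>

text \<open>The eigenvalue condition is tested against basis vectors on the left, so that operator
  identities are checked coefficient by coefficient with
  \<open>orthonormal_basis_eqI\<close>.\<close>

definition diagonal_in :: "'a::complex_hilbert set \<Rightarrow> ('a \<Rightarrow> real) \<Rightarrow> ('a \<Rightarrow>\<^sub>L 'a) \<Rightarrow> bool"
  where "diagonal_in B a T \<longleftrightarrow> orthonormal_basis B \<and>
    (\<forall>e\<in>B. \<forall>x. cinner e (blinfun_apply T x) = of_real (a e) * cinner e x)"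

lemma diagonal_in_basis: "diagonal_in B a T \<Longrightarrow> orthonormal_basis B"
  by (simp add: diagonal_in_def)

lemma diagonal_in_cinner:
  "diagonal_in B a T \<Longrightarrow> e \<in> B \<Longrightarrow> cinner e (blinfun_apply T x) = of_real (a e) * cinner e x"
  by (simp add: diagonal_in_def)

lemma diagonal_in_unique:
  assumes "diagonal_in B a S" "diagonal_in B a T"
  shows "S = T"
proof (rule blinfun_eqI)
  fix x
  show "blinfun_apply S x = blinfun_apply T x"
    using assms by (intro orthonormal_basis_eqI[OF diagonal_in_basis[OF assms(1)]])
      (simp add: diagonal_in_cinner)
qed

lemma diagonal_in_add:
  "diagonal_in B a S \<Longrightarrow> diagonal_in B b T \<Longrightarrow> diagonal_in B (\<lambda>e. a e + b e) (S + T)"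
  by (simp add: diagonal_in_def blinfun.add_left cinner_add_right algebra_simps)

lemma diagonal_in_scaleR: "diagonal_in B a T \<Longrightarrow> diagonal_in B (\<lambda>e. r * a e) (r *\<^sub>R T)"
  by (simp add: diagonal_in_def blinfun.scaleR_left cinner_scaleR_right)

lemma diagonal_in_minus:
  "diagonal_in B a S \<Longrightarrow> diagonal_in B b T \<Longrightarrow> diagonal_in B (\<lambda>e. a e - b e) (S - T)"
  by (simp add: diagonal_in_def blinfun.diff_left cinner_diff_right algebra_simps)

lemma diagonal_in_zero: "orthonormal_basis B \<Longrightarrow> diagonal_in B (\<lambda>e. 0) 0"
  by (simp add: diagonal_in_def)

lemma diagonal_in_id: "orthonormal_basis B \<Longrightarrow> diagonal_in B (\<lambda>e. 1) id_blinfun"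
  by (simp add: diagonal_in_def)

lemma diagonal_in_compose:
  "diagonal_in B a S \<Longrightarrow> diagonal_in B b T \<Longrightarrow> diagonal_in B (\<lambda>e. a e * b e) (S o\<^sub>L T)"
  by (simp add: diagonal_in_def)

lemma diagonal_in_sum:
  assumes "orthonormal_basis B" "\<And>i. i \<in> I \<Longrightarrow> diagonal_in B (a i) (T i)"
  shows "diagonal_in B (\<lambda>e. \<Sum>i\<in>I. a i e) (\<Sum>i\<in>I. T i)"
  using assms(2)
  by (induction I rule: infinite_finite_induct)
     (auto intro: diagonal_in_add diagonal_in_zero[OF assms(1)])

lemma diagonal_in_op_poly:
  assumes "diagonal_in B a T"
  shows "diagonal_in B (\<lambda>e. poly p (a e)) (op_poly p T)"
proof -
  have "diagonal_in B (\<lambda>e. a e ^ i) (((\<lambda>S. T o\<^sub>L S) ^^ i) id_blinfun)" for i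
    using assms by (induction i) (auto intro: diagonal_in_compose diagonal_in_id diagonal_in_basis)
  then show ?thesis
    unfolding op_poly_def poly_altdef
    using assms by (intro diagonal_in_sum diagonal_in_scaleR diagonal_in_basis)
qed

lemma diagonal_in_eigenvector:
  assumes "diagonal_in B a T" "f \<in> B"
  shows "blinfun_apply T f = of_real (a f) *\<^sub>C f"
  using assms orthonormal_basis_imp_orthonormal[OF diagonal_in_basis[OF assms(1)]]
  by (intro orthonormal_basis_eqI[OF diagonal_in_basis[OF assms(1)]])
     (simp add: diagonal_in_cinner cinner_scaleC_right orthonormal_def)

lemma diagonal_in_complex_linear:
  assumes "diagonal_in B a T"
  shows "complex_linear T"
  unfolding complex_linear_def
  by (intro allI orthonormal_basis_eqI[OF diagonal_in_basis[OF assms]])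
     (simp add: diagonal_in_cinner[OF assms] cinner_scaleC_right)

section \<open>Norm bounds and existence for operators with prescribed bounded eigenvalues\<close>

lemma norm_le_of_coefficients:
  assumes B: "orthonormal_basis B" and M: "M \<ge> 0"
    and le: "\<And>e. e \<in> B \<Longrightarrow> cmod (cinner e y) \<le> M * cmod (cinner e x)"
  shows "norm y \<le> M * norm x"
proof -
  have "(norm y)\<^sup>2 \<le> M\<^sup>2 * (norm x)\<^sup>2"
  proof (rule has_sum_mono[OF Parseval[OF B] has_sum_cmult_right[OF Parseval[OF B]]])
    fix e assume "e \<in> B"
    then show "(cmod (cinner e y))\<^sup>2 \<le> M\<^sup>2 * (cmod (cinner e x))\<^sup>2"
      using power_mono[OF le] by (simp add: power_mult_distrib)
  qed
  then show ?thesis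
    using M by (intro power2_le_imp_le[of "norm y"]) (auto simp: power_mult_distrib)
qed

lemma diagonal_in_norm_le:
  assumes "diagonal_in B a T" "M \<ge> 0" "\<And>e. e \<in> B \<Longrightarrow> \<bar>a e\<bar> \<le> M"
  shows "norm T \<le> M"
  using assms(2,3)
  by (intro norm_blinfun_bound norm_le_of_coefficients[OF diagonal_in_basis[OF assms(1)]])
     (auto simp: diagonal_in_cinner[OF assms(1)] norm_mult intro: mult_right_mono)

text \<open>Bounded multipliers keep the coefficients square summable, so Riesz-Fischer supplies
  each image vector. The resolvents and the functions of a diagonal operator are built this
  way.\<close>

lemma diagonal_in_exists:
  fixes B :: "'a::complex_hilbert set"
  assumes B: "orthonormal_basis B" and a: "\<And>e. e \<in> B \<Longrightarrow> \<bar>a e\<bar> \<le> M"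
  obtains T where "diagonal_in B a T"
proof -
  \<comment> \<open>For an empty basis \<open>M\<close> may be negative; the absolute value gives a
    nonnegative bound in every case.\<close>
  define K where "K = \<bar>M\<bar>"
  have K: "\<bar>a e\<bar> \<le> K" if "e \<in> B" for e
    using a[OF that] by (simp add: K_def)
  have "\<exists>y. \<forall>e\<in>B. cinner e y = of_real (a e) * cinner e x" for x :: 'a
  proof -
    have "(\<lambda>e. K\<^sup>2 * (cmod (cinner e x))\<^sup>2) summable_on B"
      using Parseval[OF B, of x] by (intro summable_on_cmult_right) (auto simp: summable_on_def)
    then have "(\<lambda>e. (cmod (of_real (a e) * cinner e x))\<^sup>2) summable_on B"
    proof (rule summable_on_comparison_test)
      fix e assume "e \<in> B"
      then show "(cmod (of_real (a e) * cinner e x))\<^sup>2 \<le> K\<^sup>2 * (cmod (cinner e x))\<^sup>2"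
        using power_mono[OF K, of e 2] by (simp add: norm_mult power_mult_distrib mult_right_mono)
    qed simp
    from Riesz_Fischer[OF orthonormal_basis_imp_orthonormal[OF B] this]
    obtain y where "\<And>e. e \<in> B \<Longrightarrow> cinner e y = of_real (a e) * cinner e x"
      by blast
    then show ?thesis
      by blast
  qed
  then obtain f where f: "\<And>x e. e \<in> B \<Longrightarrow> cinner e (f x) = of_real (a e) * cinner e x"
    by metis
  have "bounded_linear f"
  proof (rule bounded_linear_intro)
    show "f (x + y) = f x + f y" for x y
      by (rule orthonormal_basis_eqI[OF B]) (simp add: f cinner_add_right algebra_simps)
    show "f (r *\<^sub>R x) = r *\<^sub>R f x" for r x
      by (rule orthonormal_basis_eqI[OF B]) (simp add: f cinner_scaleR_right)
    show "norm (f x) \<le> norm x * K" for x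
      using norm_le_of_coefficients[OF B, of K "f x" x] K
      by (simp add: f norm_mult mult_right_mono K_def mult.commute)
  qed
  then have "diagonal_in B a (Blinfun f)"
    using B f by (simp add: diagonal_in_def bounded_linear_Blinfun_apply)
  then show ?thesis
    using that by blast
qed

text \<open>The weights \<open>(cmod (cinner e x))\<^sup>2\<close> are the spectral measure of
  \<open>T\<close> at \<open>x\<close>, a probability measure when \<open>x\<close> is a unit
  vector. Hoelder and Jensen are applied to it later.\<close>

lemma diagonal_in_has_sum_cinner:
  assumes "diagonal_in B a T"
  shows "((\<lambda>e. complex_of_real (a e * (cmod (cinner e x))\<^sup>2)) has_sum cinner x (blinfun_apply T x)) B"
proof -
  have "((\<lambda>e. cinner x (cinner e (blinfun_apply T x) *\<^sub>C e)) has_sum cinner x (blinfun_apply T x)) B"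
    using has_sum_bounded_linear[OF bounded_linear_cinner_right
      orthonormal_basis_has_sum[OF diagonal_in_basis[OF assms]]] by (simp add: o_def)
  moreover have "cinner x (cinner e (blinfun_apply T x) *\<^sub>C e)
      = complex_of_real (a e * (cmod (cinner e x))\<^sup>2)" if "e \<in> B" for e
    unfolding of_real_mult complex_norm_square diagonal_in_cinner[OF assms that] cinner_scaleC_right
    by (subst cinner_commute[of x e]) simp
  ultimately show ?thesis
    by (simp cong: has_sum_cong)
qed

lemma diagonal_in_has_sum_inner:
  assumes "diagonal_in B a T"
  shows "((\<lambda>e. a e * (cmod (cinner e x))\<^sup>2) has_sum inner x (blinfun_apply T x)) B"
  using has_sum_Re[OF diagonal_in_has_sum_cinner[OF assms, of x]] by (simp add: Re_cinner)

lemma diagonal_in_cinner_of_real: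
  assumes "diagonal_in B a T"
  shows "cinner x (blinfun_apply T x) = of_real (inner x (blinfun_apply T x))"
  using has_sum_unique[OF diagonal_in_has_sum_cinner[OF assms, of x]]
    has_sum_of_real[OF diagonal_in_has_sum_inner[OF assms, of x]] by (simp add: o_def)

lemma diagonal_in_positive:
  assumes "diagonal_in B a T" "\<And>e. e \<in> B \<Longrightarrow> 0 \<le> a e"
  shows "positive_operator T"
proof -
  have "0 \<le> inner x (blinfun_apply T x)" for x
    using assms(2) by (intro has_sum_nonneg[OF diagonal_in_has_sum_inner[OF assms(1)]]) simp
  then show ?thesis
    using diagonal_in_complex_linear[OF assms(1)] diagonal_in_cinner_of_real[OF assms(1)]
    unfolding positive_operator_def by (metis nonneg_Reals_of_real_iff)
qed

section \<open>Positive operators\<close>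

lemma positive_operator_zero: "positive_operator 0"
  by (simp add: positive_operator_def complex_linear_def)

lemma positive_operator_add:
  assumes "positive_operator S" "positive_operator T"
  shows "positive_operator (S + T)"
  using assms unfolding positive_operator_def complex_linear_def
  by (simp add: blinfun.add_left cinner_add_right scaleC_add_right)

lemma positive_operator_scaleR:
  fixes T :: "'a::complex_inner \<Rightarrow>\<^sub>L 'a"
  assumes "positive_operator T" "0 \<le> r"
  shows "positive_operator (r *\<^sub>R T)"
proof -
  have "r *\<^sub>R c *\<^sub>C x = c *\<^sub>C r *\<^sub>R x" for c and x :: 'a
    by (simp add: scaleC_scaleC mult.commute flip: scaleC_of_real)
  then show ?thesis
    using assms unfolding positive_operator_def complex_linear_def
    by (simp add: blinfun.scaleR_left cinner_scaleR_right nonneg_Reals_mult_I)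
qed

lemma positive_operator_sum:
  "(\<And>i. i \<in> I \<Longrightarrow> positive_operator (T i)) \<Longrightarrow> positive_operator (\<Sum>i\<in>I. T i)"
  by (induction I rule: infinite_finite_induct)
     (auto intro: positive_operator_add positive_operator_zero)

section \<open>The quadratic form of a positive operator\<close>

lemma positive_operator_inner_nonneg:
  "positive_operator T \<Longrightarrow> 0 \<le> inner x (blinfun_apply T x)"
  unfolding positive_operator_def complex_nonneg_Reals_iff by (simp add: Re_cinner)

text \<open>Polarization: the form is real at \<open>x + \<i> *\<^sub>C y\<close>, and the imaginary
  part of its expansion is the difference of the two sides.\<close>

lemma positive_operator_symmetric:
  assumes "positive_operator T"
  shows "inner x (blinfun_apply T y) = inner y (blinfun_apply T x)"
proof -
  have im: "Im (cinner z (blinfun_apply T z)) = 0" for z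
    using assms unfolding positive_operator_def complex_nonneg_Reals_iff by blast
  have "blinfun_apply T (\<i> *\<^sub>C y) = \<i> *\<^sub>C blinfun_apply T y"
    using assms by (simp add: positive_operator_def complex_linear_def)
  then have "Im (cinner (x + \<i> *\<^sub>C y) (blinfun_apply T (x + \<i> *\<^sub>C y)))
      = Re (cinner x (blinfun_apply T y)) - Re (cinner y (blinfun_apply T x))"
    using im[of x] im[of y]
    by (simp add: blinfun.add_right cinner_add_left cinner_add_right cinner_scaleC_left
        cinner_scaleC_right)
  then show ?thesis
    using im[of "x + \<i> *\<^sub>C y"] by (simp add: Re_cinner)
qed

lemma positive_operator_selfadjoint:
  assumes "positive_operator T"
  shows "cinner x (blinfun_apply T y) = cinner (blinfun_apply T x) y"
proof -
  have Re: "Re (cinner x (blinfun_apply T y)) = Re (cinner (blinfun_apply T x) y)" for x y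
    using positive_operator_symmetric[OF assms, of x y] by (simp add: Re_cinner inner_commute)
  have "blinfun_apply T (\<i> *\<^sub>C y) = \<i> *\<^sub>C blinfun_apply T y"
    using assms by (simp add: positive_operator_def complex_linear_def)
  then have "Im (cinner x (blinfun_apply T y)) = Im (cinner (blinfun_apply T x) y)"
    using Re[of x "\<i> *\<^sub>C y"] by (simp add: cinner_scaleC_right)
  with Re show ?thesis
    by (simp add: complex_eq_iff)
qed

lemma positive_operator_Cauchy_Schwarz:
  assumes "positive_operator T"
  shows "(inner x (blinfun_apply T y))\<^sup>2 \<le> inner x (blinfun_apply T x) * inner y (blinfun_apply T y)"
proof -
  let ?a = "inner y (blinfun_apply T y)" and ?b = "inner x (blinfun_apply T y)"
    and ?c = "inner x (blinfun_apply T x)"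
  have q: "0 \<le> ?c - 2 * t * ?b + t\<^sup>2 * ?a" for t
    using positive_operator_inner_nonneg[OF assms, of "x - t *\<^sub>R y"]
      positive_operator_symmetric[OF assms, of x y]
    by (simp add: blinfun.diff_right blinfun.scaleR_right inner_diff_left inner_diff_right
        power2_eq_square algebra_simps)
  show ?thesis
  proof (cases "?a = 0")
    case True
    have "?b = 0"
    proof (rule ccontr)
      assume "?b \<noteq> 0"
      then show False
        \<comment> \<open>With \<open>?a = 0\<close> the polynomial in \<open>q\<close> is affine in
          \<open>t\<close> and takes the value -1 at this point.\<close>
        using q[of "(?c + 1) / (2 * ?b)"] True by (simp add: field_simps)
    qed
    then show ?thesis
      using True by simp
  next
    case False
    then have "?a > 0"
      using positive_operator_inner_nonneg[OF assms, of y] by linarith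
    then show ?thesis
      \<comment> \<open>This value of \<open>t\<close> minimizes the quadratic polynomial.\<close>
      using q[of "?b / ?a"] by (simp add: field_simps power2_eq_square)
  qed
qed

text \<open>Cauchy-Schwarz for the form at \<open>T x\<close> and \<open>x\<close>, followed by
  cancelling the squared norm of \<open>T x\<close>. The bound \<open>m\<close> concerns the single
  vector \<open>T x\<close>, so it can be \<open>norm T\<close> or the supremum of the form on an
  invariant subspace.\<close>

lemma positive_operator_norm_image_le:
  assumes T: "positive_operator T"
    and le: "inner (blinfun_apply T x) (blinfun_apply T (blinfun_apply T x)) \<le> m * (norm (blinfun_apply T x))\<^sup>2"
  shows "(norm (blinfun_apply T x))\<^sup>2 \<le> m * inner x (blinfun_apply T x)"
proof (cases "blinfun_apply T x = 0")
  case False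
  let ?y = "blinfun_apply T x"
  have "((norm ?y)\<^sup>2)\<^sup>2 \<le> inner ?y (blinfun_apply T ?y) * inner x ?y"
    using positive_operator_Cauchy_Schwarz[OF T, of ?y x] by (simp add: power2_norm_eq_inner)
  also have "\<dots> \<le> (m * (norm ?y)\<^sup>2) * inner x ?y"
    by (intro mult_right_mono le positive_operator_inner_nonneg T)
  finally have "(norm ?y)\<^sup>2 * (norm ?y)\<^sup>2 \<le> (norm ?y)\<^sup>2 * (m * inner x ?y)"
    by (simp add: power2_eq_square mult_ac)
  moreover have "(norm ?y)\<^sup>2 > 0"
    using False by simp
  ultimately show ?thesis
    by (simp only: mult_le_cancel_left_pos)
qed simp

lemma inner_blinfun_le: "inner x (blinfun_apply T x) \<le> norm T * (norm x)\<^sup>2"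
  for T :: "'a::real_inner \<Rightarrow>\<^sub>L 'a"
proof -
  have "inner x (blinfun_apply T x) \<le> norm x * (norm T * norm x)"
    using norm_cauchy_schwarz[of x "blinfun_apply T x"] norm_blinfun[of T x]
    by (meson mult_left_mono norm_ge_zero order_trans)
  then show ?thesis
    by (simp add: power2_eq_square mult_ac)
qed

section \<open>Compact operators\<close>

text \<open>Equivalent to relative compactness of the image of the unit ball; containment in a
  compact set passes to sums and multiples without taking closures.\<close>

definition compact_operator :: "('a::real_normed_vector \<Rightarrow>\<^sub>L 'a) \<Rightarrow> bool"
  where "compact_operator T \<longleftrightarrow> (\<exists>K. compact K \<and> blinfun_apply T ` cball 0 1 \<subseteq> K)"

lemma compact_operator_zero: "compact_operator 0"
  unfolding compact_operator_def by (intro exI[of _ "{0}"]) auto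

lemma compact_operator_add:
  assumes "compact_operator S" "compact_operator T"
  shows "compact_operator (S + T)"
proof -
  obtain K L where K: "compact K" "blinfun_apply S ` cball 0 1 \<subseteq> K"
    and L: "compact L" "blinfun_apply T ` cball 0 1 \<subseteq> L"
    using assms unfolding compact_operator_def by blast
  then have "blinfun_apply (S + T) ` cball 0 1 \<subseteq> {x + y |x y. x \<in> K \<and> y \<in> L}"
    by (simp add: blinfun.add_left image_subset_iff) blast
  then show ?thesis
    unfolding compact_operator_def using compact_sums[OF K(1) L(1)] by blast
qed

lemma compact_operator_scaleR:
  assumes "compact_operator T"
  shows "compact_operator (r *\<^sub>R T)"
proof -
  obtain K where K: "compact K" "blinfun_apply T ` cball 0 1 \<subseteq> K"
    using assms unfolding compact_operator_def by blast
  then have "blinfun_apply (r *\<^sub>R T) ` cball 0 1 \<subseteq> (\<lambda>x. r *\<^sub>R x) ` K"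
    by (auto simp: blinfun.scaleR_left)
  then show ?thesis
    unfolding compact_operator_def using compact_scaling[OF K(1)] by blast
qed

lemma compact_operator_sum:
  "(\<And>i. i \<in> I \<Longrightarrow> compact_operator (T i)) \<Longrightarrow> compact_operator (\<Sum>i\<in>I. T i)"
  by (induction I rule: infinite_finite_induct)
     (auto intro: compact_operator_add compact_operator_zero)

text \<open>Each induction step adds one compact disc of multiples of \<open>v x\<close> as a
  Minkowski sum. The vectors are arbitrary because they will be images \<open>T e\<close>.\<close>

lemma compact_bounded_combinations:
  fixes v :: "'b \<Rightarrow> 'a::complex_inner"
  assumes "finite S"
  shows "\<exists>K. compact K \<and> (\<forall>c. (\<forall>e\<in>S. cmod (c e) \<le> 1) \<longrightarrow> (\<Sum>e\<in>S. c e *\<^sub>C v e) \<in> K)"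
  using assms
proof (induction S rule: finite_induct)
  case empty
  show ?case
    by (intro exI[of _ "{0}"]) auto
next
  case (insert x F)
  then obtain K where K: "compact K" "\<And>c. (\<forall>e\<in>F. cmod (c e) \<le> 1) \<Longrightarrow> (\<Sum>e\<in>F. c e *\<^sub>C v e) \<in> K"
    by blast
  have "compact ((\<lambda>c. c *\<^sub>C v x) ` cball 0 1)"
    by (intro compact_continuous_image compact_cball linear_continuous_on bounded_linear_scaleC_left)
  from compact_sums[OF this K(1)] show ?case
  proof (intro exI[of _ "{a + b |a b. a \<in> (\<lambda>c. c *\<^sub>C v x) ` cball 0 1 \<and> b \<in> K}"] conjI allI impI)
    fix c
    assume c: "\<forall>e\<in>insert x F. cmod (c e) \<le> 1"
    then have "c x *\<^sub>C v x \<in> (\<lambda>c. c *\<^sub>C v x) ` cball 0 1" "(\<Sum>e\<in>F. c e *\<^sub>C v e) \<in> K"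
      using K(2) by auto
    then show "(\<Sum>e\<in>insert x F. c e *\<^sub>C v e)
        \<in> {a + b |a b. a \<in> (\<lambda>c. c *\<^sub>C v x) ` cball 0 1 \<and> b \<in> K}"
      unfolding sum.insert[OF insert.hyps] by blast
  qed
qed

text \<open>\<open>T\<close> is a norm limit of finite-rank operators, so the image of the unit ball
  stays near compact sets and is totally bounded; completeness makes its closure compact.\<close>

lemma compact_operatorI:
  fixes T :: "'a::complex_hilbert \<Rightarrow>\<^sub>L 'a"
  assumes B: "orthonormal B"
    and approx: "\<And>r. r > 0 \<Longrightarrow> \<exists>S. finite S \<and> S \<subseteq> B \<and> (\<forall>x. norm x \<le> 1 \<longrightarrow>
      norm (blinfun_apply T x - (\<Sum>e\<in>S. cinner e x *\<^sub>C blinfun_apply T e)) \<le> r)"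
  shows "compact_operator T"
proof -
  let ?I = "blinfun_apply T ` cball 0 1"
  have "\<exists>k. finite k \<and> closure ?I \<subseteq> (\<Union>x\<in>k. ball x r)" if "r > 0" for r
  proof -
    have "r / 4 > 0"
      using that by simp
    from approx[OF this] obtain S where S: "finite S" "S \<subseteq> B"
      "\<And>x. norm x \<le> 1 \<Longrightarrow> norm (blinfun_apply T x - (\<Sum>e\<in>S. cinner e x *\<^sub>C blinfun_apply T e)) \<le> r / 4"
      by blast
    obtain K where K: "compact K"
      "\<And>c. (\<forall>e\<in>S. cmod (c e) \<le> 1) \<Longrightarrow> (\<Sum>e\<in>S. c e *\<^sub>C blinfun_apply T e) \<in> K"
      using compact_bounded_combinations[OF S(1)] by blast
    obtain k where k: "finite k" "K \<subseteq> (\<Union>x\<in>k. ball x (r / 4))"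
      using K(1) \<open>r / 4 > 0\<close> unfolding compact_eq_totally_bounded by blast
    \<comment> \<open>Closed balls of half the radius are used so that the inclusion survives taking
      the closure.\<close>
    have "?I \<subseteq> (\<Union>x\<in>k. cball x (r / 2))"
    proof
      fix y assume "y \<in> ?I"
      then obtain x where x: "norm x \<le> 1" "y = blinfun_apply T x"
        by auto
      let ?z = "\<Sum>e\<in>S. cinner e x *\<^sub>C blinfun_apply T e"
      have "cmod (cinner e x) \<le> 1" if "e \<in> S" for e
      proof -
        have "norm e = 1"
          using orthonormal_norm[OF B] S(2) that by blast
        then show ?thesis
          using norm_cinner_le[of e x] x(1) by simp
      qed
      then have "?z \<in> K"
        using K(2)[of "\<lambda>e. cinner e x"] by simp
      then obtain p where p: "p \<in> k" "dist p ?z < r / 4"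
        using k(2) by auto
      have "dist p y \<le> dist p ?z + dist ?z y"
        by (rule dist_triangle)
      also have "\<dots> \<le> r / 2"
        using p(2) S(3)[OF x(1)] x(2) by (simp add: dist_norm norm_minus_commute)
      finally show "y \<in> (\<Union>x\<in>k. cball x (r / 2))"
        using p(1) by auto
    qed
    then have "closure ?I \<subseteq> (\<Union>x\<in>k. cball x (r / 2))"
      by (intro closure_minimal closed_UN k(1) closed_cball ballI)
    also have "\<dots> \<subseteq> (\<Union>x\<in>k. ball x r)"
      using that by fastforce
    finally show ?thesis
      using k(1) by blast
  qed
  then have "compact (closure ?I)"
    unfolding compact_eq_totally_bounded by (simp add: complete_eq_closed)
  then show ?thesis
    unfolding compact_operator_def by (intro exI[of _ "closure ?I"] conjI closure_subset)
qed

text \<open>Dropping the eigenvalues of absolute value at most \<open>r\<close> changes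
  \<open>T\<close> by at most \<open>r\<close> in norm and leaves an operator of finite
  rank.\<close>

lemma diagonal_in_compact:
  assumes T: "diagonal_in B a T" and fin: "\<And>r. r > 0 \<Longrightarrow> finite {e\<in>B. r < \<bar>a e\<bar>}"
  shows "compact_operator T"
proof (rule compact_operatorI[OF orthonormal_basis_imp_orthonormal[OF diagonal_in_basis[OF T]]])
  fix r :: real
  assume r: "r > 0"
  let ?S = "{e\<in>B. r < \<bar>a e\<bar>}"
  have le: "norm (blinfun_apply T x - (\<Sum>e\<in>?S. cinner e x *\<^sub>C blinfun_apply T e)) \<le> r * norm x" for x
  proof (rule norm_le_of_coefficients[OF diagonal_in_basis[OF T]])
    fix f assume f: "f \<in> B"
    have "cinner f (\<Sum>e\<in>?S. cinner e x *\<^sub>C blinfun_apply T e)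
        = cinner f (\<Sum>e\<in>?S. (cinner e x * of_real (a e)) *\<^sub>C e)"
      using diagonal_in_eigenvector[OF T] by (simp add: scaleC_scaleC)
    also have "\<dots> = (if f \<in> ?S then cinner f x * of_real (a f) else 0)"
      by (rule cinner_orthonormal_sum[OF orthonormal_basis_imp_orthonormal[OF diagonal_in_basis[OF T]]
            fin[OF r] _ f]) blast
    finally show "cmod (cinner f (blinfun_apply T x - (\<Sum>e\<in>?S. cinner e x *\<^sub>C blinfun_apply T e)))
        \<le> r * cmod (cinner f x)"
      using f r by (auto simp: cinner_diff_right diagonal_in_cinner[OF T] norm_mult intro: mult_right_mono)
  qed (use r in simp)
  have "norm (blinfun_apply T x - (\<Sum>e\<in>?S. cinner e x *\<^sub>C blinfun_apply T e)) \<le> r"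
    if "norm x \<le> 1" for x
    by (rule order_trans[OF le]) (use that r in \<open>simp add: mult_le_cancel_left2\<close>)
  with fin[OF r] show "\<exists>S. finite S \<and> S \<subseteq> B \<and> (\<forall>x. norm x \<le> 1 \<longrightarrow>
      norm (blinfun_apply T x - (\<Sum>e\<in>S. cinner e x *\<^sub>C blinfun_apply T e)) \<le> r)"
    by (intro exI[of _ ?S]) auto
qed

text \<open>By Cauchy-Schwarz and Bessel the error of truncating the expansion of \<open>x\<close>
  to \<open>S\<close> is controlled by the tail of the Hilbert-Schmidt sum outside
  \<open>S\<close>.\<close>

lemma Hilbert_Schmidt_compact:
  fixes T :: "'a::complex_hilbert \<Rightarrow>\<^sub>L 'a"
  assumes B: "orthonormal_basis B" and T: "complex_linear T"
    and sm: "(\<lambda>e. (norm (blinfun_apply T e))\<^sup>2) summable_on B"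
  shows "compact_operator T"
proof (rule compact_operatorI[OF orthonormal_basis_imp_orthonormal[OF B]])
  fix r :: real
  assume r: "r > 0"
  let ?q = "sum (\<lambda>e. (norm (blinfun_apply T e))\<^sup>2)"
  obtain s where "(?q \<longlongrightarrow> s) (finite_subsets_at_top B)"
    using sm unfolding summable_on_def has_sum_def by blast
  moreover have "r\<^sup>2 / 2 > 0"
    using r by simp
  ultimately obtain S where S: "finite S" "S \<subseteq> B"
    "\<And>Y. finite Y \<Longrightarrow> S \<subseteq> Y \<Longrightarrow> Y \<subseteq> B \<Longrightarrow> dist (?q Y) s < r\<^sup>2 / 2"
    unfolding tendsto_iff eventually_finite_subsets_at_top by metis
  have "norm (blinfun_apply T x - (\<Sum>e\<in>S. cinner e x *\<^sub>C blinfun_apply T e)) \<le> r" if x: "norm x \<le> 1" for x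
  proof -
    let ?u = "\<lambda>Y. \<Sum>e\<in>Y. cinner e x *\<^sub>C blinfun_apply T e"
    have "((\<lambda>Y. blinfun_apply T (\<Sum>e\<in>Y. cinner e x *\<^sub>C e)) \<longlongrightarrow> blinfun_apply T x) (finite_subsets_at_top B)"
      using orthonormal_basis_has_sum[OF B, of x] unfolding has_sum_def by (intro tendsto_intros)
    then have "(?u \<longlongrightarrow> blinfun_apply T x) (finite_subsets_at_top B)"
      using T by (simp add: blinfun.sum_right complex_linear_def)
    then have "((\<lambda>Y. norm (?u Y - ?u S)) \<longlongrightarrow> norm (blinfun_apply T x - ?u S)) (finite_subsets_at_top B)"
      by (intro tendsto_intros)
    \<comment> \<open>The estimate is made for finite partial sums beyond \<open>S\<close> and then
      passes to the limit in \<open>Y\<close>.\<close>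
    moreover have "norm (?u Y - ?u S) \<le> r" if Y: "finite Y" "S \<subseteq> Y" "Y \<subseteq> B" for Y
    proof -
      have "?u Y - ?u S = ?u (Y - S)"
        using Y by (intro sum_diff[symmetric])
      then have "norm (?u Y - ?u S) \<le> (\<Sum>e\<in>Y - S. cmod (cinner e x) * norm (blinfun_apply T e))"
        using norm_sum[of "\<lambda>e. cinner e x *\<^sub>C blinfun_apply T e" "Y - S"] by (simp add: norm_scaleC)
      then have "(norm (?u Y - ?u S))\<^sup>2 \<le> (\<Sum>e\<in>Y - S. cmod (cinner e x) * norm (blinfun_apply T e))\<^sup>2"
        by (intro power_mono) auto
      also have "\<dots> \<le> (\<Sum>e\<in>Y - S. (cmod (cinner e x))\<^sup>2) * ?q (Y - S)"
        by (rule Cauchy_Schwarz_ineq_sum)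
      also have "\<dots> \<le> 1 * r\<^sup>2"
      proof (rule mult_mono)
        have "(\<Sum>e\<in>Y - S. (cmod (cinner e x))\<^sup>2) \<le> (norm x)\<^sup>2"
          using Y by (intro Bessel_finite orthonormal_subset[OF orthonormal_basis_imp_orthonormal[OF B]]) auto
        also have "\<dots> \<le> 1"
          using x by (simp add: power_le_one)
        finally show "(\<Sum>e\<in>Y - S. (cmod (cinner e x))\<^sup>2) \<le> 1" .
        have "?q (Y - S) = ?q Y - ?q S"
          using Y by (intro sum_diff)
        also have "\<dots> \<le> r\<^sup>2"
          using S(3)[OF Y] S(3)[OF S(1) order_refl S(2)] unfolding dist_real_def by argo
        finally show "?q (Y - S) \<le> r\<^sup>2" .
      qed (auto intro: sum_nonneg)
      finally have "(norm (?u Y - ?u S))\<^sup>2 \<le> r\<^sup>2"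
        by simp
      then show ?thesis
        by (rule power2_le_imp_le) (use r in simp)
    qed
    ultimately show ?thesis
      using S(1,2)
      by (intro tendsto_upperbound[of _ _ "finite_subsets_at_top B"])
         (auto simp: eventually_finite_subsets_at_top)
  qed
  with S show "\<exists>S. finite S \<and> S \<subseteq> B \<and> (\<forall>x. norm x \<le> 1 \<longrightarrow>
      norm (blinfun_apply T x - (\<Sum>e\<in>S. cinner e x *\<^sub>C blinfun_apply T e)) \<le> r)"
    by blast
qed

text \<open>The squared norm of \<open>T e\<close> is at most \<open>norm T\<close> times the
  diagonal entry at \<open>e\<close>, so a finite trace makes \<open>T\<close>
  Hilbert-Schmidt.\<close>

lemma trace_class_positive_compact:
  fixes T :: "'a::complex_hilbert \<Rightarrow>\<^sub>L 'a"
  assumes B: "orthonormal_basis B" and T: "positive_operator T"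
    and sm: "(\<lambda>e. inner e (blinfun_apply T e)) summable_on B"
  shows "compact_operator T"
proof (rule Hilbert_Schmidt_compact[OF B])
  show "complex_linear T"
    using T by (simp add: positive_operator_def)
  show "(\<lambda>e. (norm (blinfun_apply T e))\<^sup>2) summable_on B"
    by (rule summable_on_comparison_test[OF summable_on_cmult_right[OF sm, of "norm T"]])
       (auto intro: positive_operator_norm_image_le[OF T] inner_blinfun_le)
qed

section \<open>The spectral theorem for compact positive operators\<close>

text \<open>A maximizing sequence for the quadratic form on the unit sphere of the invariant subspace
  \<open>M\<close> satisfies \<open>T x\<^sub>n - m x\<^sub>n \<rightarrow> 0\<close> for the supremum \<open>m\<close>, so by compactness it subconverges.\<close>

lemma compact_positive_eigenvector:
  fixes T :: "'a::complex_hilbert \<Rightarrow>\<^sub>L 'a"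
  assumes T: "positive_operator T" and compact: "compact_operator T"
    and M: "closed M" "\<And>x r. x \<in> M \<Longrightarrow> r *\<^sub>R x \<in> M" "\<And>x. x \<in> M \<Longrightarrow> blinfun_apply T x \<in> M"
    and x0: "x0 \<in> M" "x0 \<noteq> 0"
  obtains u r where "u \<in> M" "norm u = 1" "blinfun_apply T u = r *\<^sub>R u"
proof -
  define Q where "Q x = inner x (blinfun_apply T x)" for x
  define V where "V = {x\<in>M. norm x = 1}"
  define m where "m = (SUP x\<in>V. Q x)"
  have normalized: "(1 / norm x) *\<^sub>R x \<in> V" if "x \<in> M" "x \<noteq> 0" for x
    using that M(2) by (simp add: V_def)
  have "Q x \<le> norm T" if "x \<in> V" for x
    using inner_blinfun_le[of x T] that by (simp add: Q_def V_def)
  then have bdd: "bdd_above (Q ` V)"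
    by (rule bdd_aboveI2)
  have Q_nonneg: "0 \<le> Q x" for x
    unfolding Q_def by (rule positive_operator_inner_nonneg[OF T])
  have V_le: "Q x \<le> m" if "x \<in> V" for x
    unfolding m_def by (rule cSUP_upper[OF that bdd])
  have u0: "(1 / norm x0) *\<^sub>R x0 \<in> V"
    by (rule normalized[OF x0])
  have m_nonneg: "0 \<le> m"
    using Q_nonneg V_le[OF u0] order_trans by blast
  have Q_le: "Q x \<le> m * (norm x)\<^sup>2" if x: "x \<in> M" for x
  proof (cases "x = 0")
    case False
    have "Q x / (norm x)\<^sup>2 = Q ((1 / norm x) *\<^sub>R x)"
      by (simp add: Q_def blinfun.scaleR_right power2_eq_square)
    also have "\<dots> \<le> m"
      by (rule V_le[OF normalized[OF x False]])
    finally show ?thesis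
      using False by (simp add: divide_le_eq)
  qed (simp add: Q_def)
  have image_le: "(norm (blinfun_apply T x))\<^sup>2 \<le> m * Q x" if "x \<in> M" for x
    unfolding Q_def
    by (rule positive_operator_norm_image_le[OF T]) (use Q_le[OF M(3)[OF that]] in \<open>simp add: Q_def\<close>)
  show ?thesis
  proof (cases "m = 0")
    \<comment> \<open>A zero supremum makes \<open>T\<close> vanish on \<open>M\<close>, so any unit
      vector of \<open>M\<close> is an eigenvector; the other case divides by
      \<open>m\<close>.\<close>
    case True
    let ?u = "(1 / norm x0) *\<^sub>R x0"
    have "blinfun_apply T ?u = 0 *\<^sub>R ?u"
      using image_le[of ?u] u0 True unfolding V_def by simp
    with u0 show ?thesis
      using that unfolding V_def by blast
  next
    case False
    with m_nonneg have m: "m > 0"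
      by simp
    have "\<exists>x\<in>V. m - inverse (Suc n) < Q x" for n
    proof -
      have "m - inverse (Suc n) < m"
        by simp
      then show ?thesis
        using less_cSUP_iff[OF _ bdd, of "m - inverse (Suc n)"] u0 unfolding m_def[symmetric] by blast
    qed
    then obtain x where x: "\<And>n. x n \<in> V" "\<And>n. m - inverse (Suc n) < Q (x n)"
      by metis
    have x_norm: "norm (x n) = 1" and x_M: "x n \<in> M" for n
      using x(1) by (auto simp: V_def)
    obtain K where K: "compact K" "blinfun_apply T ` cball 0 1 \<subseteq> K"
      using compact unfolding compact_operator_def by blast
    have "\<forall>n. blinfun_apply T (x n) \<in> K"
      using K(2) x_norm by (simp add: image_subset_iff)
    then obtain z k where k: "strict_mono (k :: nat \<Rightarrow> nat)"
      and z: "((\<lambda>n. blinfun_apply T (x n)) \<circ> k) \<longlonglongrightarrow> z"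
      by (rule seq_compactE[OF compact_imp_seq_compact[OF K(1)]])
    have lim0: "(\<lambda>n. sqrt (m * inverse (Suc n))) \<longlonglongrightarrow> 0"
      using tendsto_real_sqrt[OF tendsto_mult_right_zero[OF LIMSEQ_inverse_real_of_nat, of m]] by simp
    have "norm (blinfun_apply T (x n) - m *\<^sub>R x n) \<le> sqrt (m * inverse (Suc n))" for n
    proof (rule real_le_rsqrt)
      have "(norm (blinfun_apply T (x n) - m *\<^sub>R x n))\<^sup>2
          = (norm (blinfun_apply T (x n)))\<^sup>2 - 2 * m * Q (x n) + m\<^sup>2"
        using x_norm[of n]
        by (simp add: power2_norm_eq_inner inner_diff_left inner_diff_right Q_def inner_commute
            norm_eq_1 power2_eq_square[of m] algebra_simps)
      also have "\<dots> \<le> m * Q (x n) - 2 * m * Q (x n) + m\<^sup>2"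
        using image_le[OF x_M] by simp
      also have "\<dots> = m * (m - Q (x n))"
        by (simp add: power2_eq_square algebra_simps)
      also have "\<dots> \<le> m * inverse (Suc n)"
        using x(2)[of n] m by (intro mult_left_mono) auto
      finally show "(norm (blinfun_apply T (x n) - m *\<^sub>R x n))\<^sup>2 \<le> m * inverse (Suc n)" .
    qed
    then have "(\<lambda>n. blinfun_apply T (x n) - m *\<^sub>R x n) \<longlonglongrightarrow> 0"
      by (intro Lim_null_comparison[OF _ lim0] always_eventually allI)
    \<comment> \<open>The images converge along \<open>k\<close> by compactness and differ from
      \<open>m *\<^sub>R x (k n)\<close> by a null sequence, so the vectors themselves
      converge.\<close>
    from tendsto_diff[OF z LIMSEQ_subseq_LIMSEQ[OF this k]]
    have "(\<lambda>n. m *\<^sub>R x (k n)) \<longlonglongrightarrow> z"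
      by (simp add: o_def)
    from tendsto_scaleR[OF tendsto_const[of "1 / m"] this]
    have u: "(\<lambda>n. x (k n)) \<longlonglongrightarrow> (1 / m) *\<^sub>R z"
      using m by simp
    have "(1 / m) *\<^sub>R z \<in> M"
      by (rule closed_sequentially[OF M(1) _ u]) (rule x_M)
    moreover have "norm ((1 / m) *\<^sub>R z) = 1"
      using LIMSEQ_unique[OF tendsto_norm[OF u, unfolded x_norm] tendsto_const] .
    moreover have "blinfun_apply T ((1 / m) *\<^sub>R z) = m *\<^sub>R (1 / m) *\<^sub>R z"
    proof (rule LIMSEQ_unique)
      show "(\<lambda>n. blinfun_apply T (x (k n))) \<longlonglongrightarrow> blinfun_apply T ((1 / m) *\<^sub>R z)"
        by (intro tendsto_intros u)
      show "(\<lambda>n. blinfun_apply T (x (k n))) \<longlonglongrightarrow> m *\<^sub>R (1 / m) *\<^sub>R z"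
        using z m by (simp add: o_def)
    qed
    ultimately show ?thesis
      by (rule that)
  qed
qed

lemma closed_orthogonal_complement:
  fixes F :: "'a::complex_inner set"
  shows "closed {x. \<forall>f\<in>F. cinner f x = 0}"
proof -
  have "{x. \<forall>f\<in>F. cinner f x = 0} = (\<Inter>f\<in>F. {x. cinner f x = 0})"
    by blast
  moreover have "closed {x. cinner f x = 0}" for f :: 'a
    by (intro closed_Collect_eq linear_continuous_on bounded_linear_cinner_right continuous_on_const)
  ultimately show ?thesis
    by (simp add: closed_INT)
qed

text \<open>Zorn gives a maximal orthonormal family of eigenvectors. Its orthogonal complement is
  closed and invariant under \<open>T\<close>, so if it were nonzero it would contain a further unit
  eigenvector.\<close>

lemma compact_positive_diagonalization:
  fixes T :: "'a::complex_hilbert \<Rightarrow>\<^sub>L 'a"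
  assumes T: "positive_operator T" and compact: "compact_operator T"
  obtains B a where "diagonal_in B a T" "\<And>e. e \<in> B \<Longrightarrow> 0 \<le> a e" "\<And>e. e \<in> B \<Longrightarrow> a e \<le> norm T"
proof -
  define A where "A = {F. orthonormal F \<and> (\<forall>f\<in>F. \<exists>r. blinfun_apply T f = r *\<^sub>R f)}"
  have "\<Union>C \<in> A" if C: "subset.chain A C" for C
  proof -
    have "cinner e f = (if e = f then 1 else 0)" if ef: "e \<in> \<Union>C" "f \<in> \<Union>C" for e f
    proof -
      obtain X Y where XY: "e \<in> X" "X \<in> C" "f \<in> Y" "Y \<in> C"
        using ef by blast
      then obtain Z where "e \<in> Z" "f \<in> Z" "Z \<in> A"
        using C unfolding subset_chain_def by blast
      then show ?thesis
        unfolding A_def orthonormal_def by blast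
    qed
    moreover have "\<exists>r. blinfun_apply T f = r *\<^sub>R f" if "f \<in> \<Union>C" for f
      using C that unfolding subset_chain_def A_def by blast
    ultimately show ?thesis
      unfolding A_def orthonormal_def by blast
  qed
  then obtain B where "B \<in> A" and max: "\<And>F. F \<in> A \<Longrightarrow> B \<subseteq> F \<Longrightarrow> F = B"
    using subset_Zorn'[of A] by blast
  then have B: "orthonormal B" and eigen: "\<And>f. f \<in> B \<Longrightarrow> \<exists>r. blinfun_apply T f = r *\<^sub>R f"
    unfolding A_def by blast+
  then obtain a where a: "\<And>f. f \<in> B \<Longrightarrow> blinfun_apply T f = a f *\<^sub>R f"
    by metis
  have coefficient: "cinner f (blinfun_apply T x) = of_real (a f) * cinner f x" if "f \<in> B" for f x
    using positive_operator_selfadjoint[OF T, of f x] a[OF that] by (simp add: cinner_scaleR_left)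
  have "orthonormal_basis B"
  proof (rule orthonormal_basisI[OF B], rule ccontr)
    fix x0
    assume x0: "\<And>e. e \<in> B \<Longrightarrow> cinner e x0 = 0" "x0 \<noteq> 0"
    let ?M = "{x. \<forall>f\<in>B. cinner f x = 0}"
    obtain u r where u: "u \<in> ?M" "norm u = 1" "blinfun_apply T u = r *\<^sub>R u"
    proof (rule compact_positive_eigenvector[OF T compact closed_orthogonal_complement])
      show "r *\<^sub>R x \<in> ?M" if "x \<in> ?M" for x r
        using that by (simp add: cinner_scaleR_right)
      show "blinfun_apply T x \<in> ?M" if "x \<in> ?M" for x
        using that by (simp add: coefficient)
      show "x0 \<in> ?M" "x0 \<noteq> 0"
        using x0 by auto
    qed
    have uu: "cinner u u = 1"
      using u(2) by (simp add: cinner_self)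
    have "cinner f u = 0" "cinner u f = 0" if "f \<in> B" for f
      using u(1) that cinner_commute[of u f] by auto
    then have "insert u B \<in> A"
      using B uu u(3) eigen unfolding A_def orthonormal_def by auto
    then have "u \<in> B"
      using max by blast
    with u(1) uu show False
      by auto
  qed
  then have diag: "diagonal_in B a T"
    using coefficient by (simp add: diagonal_in_def)
  have a_eq: "a e = inner e (blinfun_apply T e)" if "e \<in> B" for e
    using a[OF that] orthonormal_norm[OF B that] by (simp add: power2_norm_eq_inner[symmetric])
  show ?thesis
  proof (rule that[OF diag])
    fix e assume e: "e \<in> B"
    show "0 \<le> a e"
      unfolding a_eq[OF e] by (rule positive_operator_inner_nonneg[OF T])
    show "a e \<le> norm T"
      using inner_blinfun_le[of e T] orthonormal_norm[OF B e] by (simp add: a_eq[OF e])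
  qed
qed

text \<open>Diagonalizing the zero operator produces a basis. This gives the \<open>SOME\<close> in
  \<open>op_trace\<close> its meaning.\<close>

lemma orthonormal_basis_exists: "\<exists>B :: 'a::complex_hilbert set. orthonormal_basis B"
proof -
  obtain B :: "'a set" and a where "diagonal_in B a 0"
    by (rule compact_positive_diagonalization[OF positive_operator_zero compact_operator_zero])
  then show ?thesis
    using diagonal_in_basis by blast
qed

section \<open>Powers of diagonal operators\<close>

text \<open>Outside the interval the numbers \<open>1 / (a e - t)\<close> are bounded by the inverse
  of the distance \<open>d\<close>, and the diagonal operator they define is a two-sided inverse of
  \<open>T - t\<close>.\<close>

lemma spectrum_diagonal_subset:
  assumes T: "diagonal_in B a T" and a: "\<And>e. e \<in> B \<Longrightarrow> 0 \<le> a e \<and> a e \<le> M"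
  shows "{t. complex_of_real t \<in> spectrum T} \<subseteq> {0..M}"
proof (rule ccontr)
  assume "\<not> ?thesis"
  then obtain t where t: "complex_of_real t \<in> spectrum T" "t < 0 \<or> M < t"
    by fastforce
  define d where "d = (if t < 0 then - t else t - M)"
  have d: "d > 0" "\<And>e. e \<in> B \<Longrightarrow> d \<le> \<bar>a e - t\<bar>"
    using t(2) a by (fastforce simp: d_def)+
  have "\<bar>1 / (a e - t)\<bar> \<le> 1 / d" if "e \<in> B" for e
    using d(1) d(2)[OF that] by (simp add: abs_divide frac_le)
  then obtain S where S: "diagonal_in B (\<lambda>e. 1 / (a e - t)) S"
    by (rule diagonal_in_exists[OF diagonal_in_basis[OF T]])
  have inv: "of_real (a e - t) * of_real (1 / (a e - t)) = (1::complex)" if "e \<in> B" for e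
    using d(1) d(2)[OF that] unfolding of_real_mult[symmetric] by simp
  have "blinfun_apply S (blinfun_apply T x - of_real t *\<^sub>C x) = x" for x
  proof (rule orthonormal_basis_eqI[OF diagonal_in_basis[OF T]])
    fix e assume e: "e \<in> B"
    have "cinner e (blinfun_apply S (blinfun_apply T x - of_real t *\<^sub>C x))
        = (of_real (a e - t) * of_real (1 / (a e - t))) * cinner e x"
      by (simp only: diagonal_in_cinner[OF S e] cinner_diff_right diagonal_in_cinner[OF T e]
          cinner_scaleC_right of_real_diff algebra_simps)
    then show "cinner e (blinfun_apply S (blinfun_apply T x - of_real t *\<^sub>C x)) = cinner e x"
      unfolding inv[OF e] by simp
  qed
  moreover have "blinfun_apply T (blinfun_apply S x) - of_real t *\<^sub>C blinfun_apply S x = x" for x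
  proof (rule orthonormal_basis_eqI[OF diagonal_in_basis[OF T]])
    fix e assume e: "e \<in> B"
    have "cinner e (blinfun_apply T (blinfun_apply S x) - of_real t *\<^sub>C blinfun_apply S x)
        = (of_real (a e - t) * of_real (1 / (a e - t))) * cinner e x"
      by (simp only: diagonal_in_cinner[OF S e] cinner_diff_right diagonal_in_cinner[OF T e]
          cinner_scaleC_right of_real_diff algebra_simps)
    then show "cinner e (blinfun_apply T (blinfun_apply S x) - of_real t *\<^sub>C blinfun_apply S x) = cinner e x"
      unfolding inv[OF e] by simp
  qed
  ultimately show False
    using t(1) diagonal_in_complex_linear[OF S] unfolding spectrum_def by blast
qed

text \<open>Ensures that uniform convergence on the spectrum controls all eigenvalues at
  once.\<close>

lemma eigenvalue_in_spectrum:
  assumes T: "diagonal_in B a T" and e: "e \<in> B"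
  shows "complex_of_real (a e) \<in> spectrum T"
proof (rule ccontr)
  assume "\<not> ?thesis"
  then obtain S where "blinfun_apply S (blinfun_apply T e - of_real (a e) *\<^sub>C e) = e"
    unfolding spectrum_def by blast
  then have "e = 0"
    unfolding diagonal_in_eigenvector[OF assms] by simp
  then show False
    using orthonormal_norm[OF orthonormal_basis_imp_orthonormal[OF diagonal_in_basis[OF T]] e] by simp
qed

lemma Weierstrass_poly_sequence:
  fixes f :: "real \<Rightarrow> real"
  assumes "compact S" "continuous_on S f"
  obtains p where "uniform_limit S (\<lambda>n. poly (p n)) f sequentially"
proof -
  have "\<exists>p. \<forall>x\<in>S. \<bar>f x - poly p x\<bar> < inverse (Suc n)" for n
  proof -
    obtain g where g: "real_polynomial_function g" "\<And>x. x \<in> S \<Longrightarrow> \<bar>f x - g x\<bar> < inverse (Suc n)"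
      by (rule Stone_Weierstrass_real_polynomial_function[OF assms, of "inverse (Suc n)"]) auto
    obtain a k where "g = (\<lambda>x. \<Sum>i\<le>k. a i * x ^ i)"
      using g(1) unfolding real_polynomial_function_iff_sum by blast
    then have "g = poly (\<Sum>i\<le>k. monom (a i) i)"
      by (simp add: fun_eq_iff poly_sum poly_monom)
    with g(2) show ?thesis
      by blast
  qed
  then obtain p where p: "\<And>n x. x \<in> S \<Longrightarrow> \<bar>f x - poly (p n) x\<bar> < inverse (Suc n)"
    by metis
  have "uniform_limit S (\<lambda>n. poly (p n)) f sequentially"
  proof (rule uniform_limitI)
    fix r :: real
    assume "r > 0"
    then have "\<forall>\<^sub>F n in sequentially. inverse (Suc n) < r"
      using LIMSEQ_inverse_real_of_nat by (rule order_tendstoD(2)[rotated])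
    then show "\<forall>\<^sub>F n in sequentially. \<forall>x\<in>S. dist (poly (p n) x) (f x) < r"
    proof eventually_elim
      case (elim n)
      show ?case
      proof
        fix x assume "x \<in> S"
        from p[OF this, of n] elim show "dist (poly (p n) x) (f x) < r"
          unfolding dist_real_def by linarith
      qed
    qed
  qed
  then show ?thesis
    by (rule that)
qed

lemma functional_calculus_diagonal:
  assumes T: "diagonal_in B a T" and a: "\<And>e. e \<in> B \<Longrightarrow> 0 \<le> a e \<and> a e \<le> M"
    and f: "continuous_on {0..M} f"
  shows "diagonal_in B (\<lambda>e. f (a e)) (functional_calculus f T)"
proof -
  have "bounded (f ` {0..M})"
    by (intro compact_imp_bounded compact_continuous_image f) simp
  then obtain L where "\<forall>y\<in>f ` {0..M}. norm y \<le> L"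
    unfolding bounded_iff by blast
  then have "\<bar>f (a e)\<bar> \<le> L" if "e \<in> B" for e
    using a[OF that] by simp
  then obtain S where S: "diagonal_in B (\<lambda>e. f (a e)) S"
    by (rule diagonal_in_exists[OF diagonal_in_basis[OF T]])
  have lim: "(\<lambda>n. op_poly (p n) T) \<longlonglongrightarrow> S"
    if p: "uniform_limit {t. complex_of_real t \<in> spectrum T} (\<lambda>n. poly (p n)) f sequentially" for p
    unfolding tendsto_iff
  proof (intro allI impI)
    fix r :: real
    assume r: "r > 0"
    then have "\<forall>\<^sub>F n in sequentially. \<forall>t\<in>{t. complex_of_real t \<in> spectrum T}. dist (poly (p n) t) (f t) < r / 2"
      using p unfolding uniform_limit_iff by (meson half_gt_zero)
    then show "\<forall>\<^sub>F n in sequentially. dist (op_poly (p n) T) S < r"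
    proof eventually_elim
      case (elim n)
      have "norm (op_poly (p n) T - S) \<le> r / 2"
      proof (rule diagonal_in_norm_le[OF diagonal_in_minus[OF diagonal_in_op_poly[OF T] S]])
        show "\<bar>poly (p n) (a e) - f (a e)\<bar> \<le> r / 2" if "e \<in> B" for e
          using elim eigenvalue_in_spectrum[OF T that] by (simp add: dist_real_def less_imp_le)
      qed (use r in simp)
      with r show ?case
        by (simp add: dist_norm)
    qed
  qed
  \<comment> \<open>Without an approximating sequence the condition defining
    \<open>functional_calculus\<close> would be vacuous; Weierstrass on \<open>{0..M}\<close>
    supplies one and pins down the limit.\<close>
  obtain q where "uniform_limit {0..M} (\<lambda>n. poly (q n)) f sequentially"
    by (rule Weierstrass_poly_sequence[OF _ f]) simp
  then have q: "uniform_limit {t. complex_of_real t \<in> spectrum T} (\<lambda>n. poly (q n)) f sequentially"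
    by (rule uniform_limit_on_subset[OF _ spectrum_diagonal_subset[OF T a]])
  have "functional_calculus f T = S"
    unfolding functional_calculus_def
  proof (rule the_equality)
    fix R
    assume R: "\<forall>p. uniform_limit {t. complex_of_real t \<in> spectrum T} (\<lambda>n. poly (p n)) f sequentially \<longrightarrow>
      (\<lambda>n. op_poly (p n) T) \<longlonglongrightarrow> R"
    then have "(\<lambda>n. op_poly (q n) T) \<longlonglongrightarrow> R"
      using q by blast
    then show "R = S"
      by (rule LIMSEQ_unique[OF _ lim[OF q]])
  qed (use lim in blast)
  with S show ?thesis
    by simp
qed

text \<open>Positivity of \<open>r\<close> makes the power function continuous at 0, where
  eigenvalues may lie or accumulate.\<close>

lemma op_powr_diagonal:
  assumes "diagonal_in B a T" "\<And>e. e \<in> B \<Longrightarrow> 0 \<le> a e \<and> a e \<le> M" "r > 0"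
  shows "diagonal_in B (\<lambda>e. a e powr r) (op_powr T r)"
  unfolding op_powr_def using assms(3)
  by (intro functional_calculus_diagonal[OF assms(1,2)] continuous_on_powr') (auto intro: continuous_intros)

section \<open>The trace\<close>

text \<open>Tonelli for unordered sums: nonnegativity and summable row totals make the double family
  summable, so both iterated sums agree.\<close>

lemma nonneg_has_sum_exchange:
  fixes w :: "'a \<Rightarrow> 'b \<Rightarrow> real"
  assumes w: "\<And>e f. e \<in> A \<Longrightarrow> f \<in> B \<Longrightarrow> 0 \<le> w e f"
    and rows: "\<And>e. e \<in> A \<Longrightarrow> (w e has_sum g e) B"
    and columns: "\<And>f. f \<in> B \<Longrightarrow> ((\<lambda>e. w e f) has_sum h f) A"
    and g: "(g has_sum c) A"
  shows "(h has_sum c) B"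
proof -
  have "(\<lambda>(e, f). w e f) summable_on A \<times> B"
    using rows g w by (intro summable_on_SigmaI[where g = g]) (auto simp: summable_on_def)
  then have "((\<lambda>(e, f). w e f) has_sum c) (A \<times> B)"
    using rows g by (intro has_sum_SigmaI[where g = g]) auto
  then have "((\<lambda>(f, e). w e f) has_sum c) (B \<times> A)"
    by (subst (asm) has_sum_swap) simp
  then show ?thesis
    by (rule has_sum_SigmaD) (use columns in auto)
qed

text \<open>In the double family \<open>a f * (cmod (cinner f e))\<^sup>2\<close> summing over
  \<open>f\<close> gives the diagonal entry at \<open>e\<close>, and summing over \<open>e\<close>
  gives \<open>a f\<close> by Parseval. Stated as an equivalence, it transfers finiteness in both
  directions.\<close>

lemma has_sum_trace_iff:
  assumes T: "diagonal_in B a T" and a: "\<And>f. f \<in> B \<Longrightarrow> 0 \<le> a f" and E: "orthonormal_basis E"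
  shows "((\<lambda>e. inner e (blinfun_apply T e)) has_sum c) E \<longleftrightarrow> (a has_sum c) B"
proof -
  let ?w = "\<lambda>e f. a f * (cmod (cinner f e))\<^sup>2"
  have rows: "(?w e has_sum inner e (blinfun_apply T e)) B" for e
    by (rule diagonal_in_has_sum_inner[OF T])
  have columns: "((\<lambda>e. ?w e f) has_sum a f) E" if "f \<in> B" for f
  proof -
    have "cmod (cinner f e) = cmod (cinner e f)" for e
      by (metis cinner_commute complex_mod_cnj)
    then show ?thesis
      using has_sum_cmult_right[OF Parseval[OF E, of f], of "a f"]
        orthonormal_norm[OF orthonormal_basis_imp_orthonormal[OF diagonal_in_basis[OF T]] that] by simp
  qed
  show ?thesis
  proof
    assume "((\<lambda>e. inner e (blinfun_apply T e)) has_sum c) E"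
    then show "(a has_sum c) B"
      by (rule nonneg_has_sum_exchange[where w = ?w, rotated 3]) (use rows columns a in auto)
  next
    assume "(a has_sum c) B"
    then show "((\<lambda>e. inner e (blinfun_apply T e)) has_sum c) E"
      by (rule nonneg_has_sum_exchange[where w = "\<lambda>f e. ?w e f", rotated 3])
         (use rows columns a in auto)
  qed
qed

lemma op_trace_diagonal:
  assumes T: "diagonal_in B a T" and a: "\<And>f. f \<in> B \<Longrightarrow> 0 \<le> a f" and c: "(a has_sum c) B"
  shows "op_trace T = of_real c"
proof -
  have "orthonormal_basis (SOME B :: 'a set. orthonormal_basis B)"
    by (rule someI_ex[OF orthonormal_basis_exists])
  from c has_sum_trace_iff[OF T a this]
  have "((\<lambda>e. inner e (blinfun_apply T e)) has_sum c) (SOME B. orthonormal_basis B)"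
    by blast
  from has_sum_of_real[OF this] show ?thesis
    unfolding op_trace_def diagonal_in_cinner_of_real[OF T] by (intro infsumI) (simp add: o_def)
qed

lemma density_operator_diagonalization:
  fixes W :: "'a::complex_hilbert \<Rightarrow>\<^sub>L 'a"
  assumes "density_operator W"
  obtains B a where "diagonal_in B a W" "\<And>e. e \<in> B \<Longrightarrow> 0 \<le> a e" "(a has_sum 1) B"
proof -
  let ?E = "SOME B :: 'a set. orthonormal_basis B"
  have W: "positive_operator W" and tr: "op_trace W = 1"
    using assms by (auto simp: density_operator_def)
  have E: "orthonormal_basis ?E"
    by (rule someI_ex[OF orthonormal_basis_exists])
  \<comment> \<open>A non-summable diagonal would give \<open>infsum\<close> the default value 0,
    contradicting trace 1.\<close>
  have "(\<lambda>e. cinner e (blinfun_apply W e)) summable_on ?E"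
    using tr infsum_not_exists[of "\<lambda>e. cinner e (blinfun_apply W e)" ?E] unfolding op_trace_def by force
  then have "((\<lambda>e. cinner e (blinfun_apply W e)) has_sum 1) ?E"
    using tr unfolding op_trace_def by (simp add: has_sum_iff)
  from has_sum_Re[OF this] have sum: "((\<lambda>e. inner e (blinfun_apply W e)) has_sum 1) ?E"
    by (simp add: Re_cinner)
  then have "compact_operator W"
    by (intro trace_class_positive_compact[OF E W]) (auto simp: summable_on_def)
  from compact_positive_diagonalization[OF W this]
  obtain B a where a: "diagonal_in B a W" "\<And>e. e \<in> B \<Longrightarrow> 0 \<le> a e"
    by metis
  with sum have "(a has_sum 1) B"
    using has_sum_trace_iff[OF a E] by simp
  with a show ?thesis
    by (rule that)
qed

section \<open>Inequalities for infinite sums\<close>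

text \<open>Young's inequality is applied termwise to \<open>a i / A\<close> and
  \<open>b i / B\<close> and then summed. Since \<open>c i\<close> need only be bounded by the
  product, the output of one application can feed the next.\<close>

lemma Holder_has_sum:
  fixes a b c :: "'i \<Rightarrow> real"
  assumes nonneg: "\<And>i. i \<in> I \<Longrightarrow> 0 \<le> a i" "\<And>i. i \<in> I \<Longrightarrow> 0 \<le> b i"
    and sums: "(a has_sum A) I" "(b has_sum B) I" "(c has_sum C) I"
    and l: "0 < l" "l < 1"
    and le: "\<And>i. i \<in> I \<Longrightarrow> c i \<le> a i powr l * b i powr (1 - l)"
  shows "C \<le> A powr l * B powr (1 - l)"
proof (cases "A = 0 \<or> B = 0")
  case True
  have "c i \<le> 0" if "i \<in> I" for i
    using True
  proof
    assume "A = 0"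
    then have "a i = 0"
      using nonneg_has_sum_le_0D[OF sums(1) _ nonneg(1) that] by simp
    then show ?thesis
      using le[OF that] by simp
  next
    assume "B = 0"
    then have "b i = 0"
      using nonneg_has_sum_le_0D[OF sums(2) _ nonneg(2) that] by simp
    then show ?thesis
      using le[OF that] by simp
  qed
  then have "C \<le> 0"
    by (rule has_sum_mono[OF sums(3) has_sum_0_simp])
  also have "0 \<le> A powr l * B powr (1 - l)"
    by simp
  finally show ?thesis .
next
  case False
  then have pos: "A > 0" "B > 0"
    using has_sum_nonneg[OF sums(1) nonneg(1)] has_sum_nonneg[OF sums(2) nonneg(2)] by linarith+
  let ?D = "A powr l * B powr (1 - l)"
  have "((\<lambda>i. ?D * (l / A * a i + (1 - l) / B * b i)) has_sum ?D * (l / A * A + (1 - l) / B * B)) I"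
    by (intro has_sum_cmult_right has_sum_add sums)
  then have "((\<lambda>i. ?D * (l / A * a i + (1 - l) / B * b i)) has_sum ?D) I"
    using pos by simp
  moreover have "c i \<le> ?D * (l / A * a i + (1 - l) / B * b i)" if i: "i \<in> I" for i
  proof -
    have young: "(a i / A) powr l * (b i / B) powr (1 - l) \<le> l * (a i / A) + (1 - l) * (b i / B)"
    proof (cases "a i = 0 \<or> b i = 0")
      case True
      then show ?thesis
        using nonneg[OF i] pos l by auto
    next
      case False
      then show ?thesis
        using Youngs_inequality_0[of l "1 - l" "a i / A" "b i / B"] nonneg[OF i] pos l by simp
    qed
    have "c i \<le> ?D * ((a i / A) powr l * (b i / B) powr (1 - l))"
      using le[OF i] nonneg[OF i] pos by (simp add: powr_divide)
    also have "\<dots> \<le> ?D * (l * (a i / A) + (1 - l) * (b i / B))"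
      by (intro mult_left_mono young) simp
    finally show ?thesis
      by simp
  qed
  ultimately show ?thesis
    using has_sum_mono[OF sums(3)] by blast
qed

text \<open>Hoelder with exponent \<open>1 / p\<close> for the splitting of \<open>a i * q i\<close>
  into \<open>(a i powr p * q i) powr (1 / p)\<close> and \<open>q i powr (1 - 1 / p)\<close>. The
  case \<open>p = 1\<close> is separate because Hoelder asks for an exponent below 1.\<close>

lemma Jensen_powr_has_sum:
  fixes a q :: "'i \<Rightarrow> real"
  assumes nonneg: "\<And>i. i \<in> I \<Longrightarrow> 0 \<le> a i" "\<And>i. i \<in> I \<Longrightarrow> 0 \<le> q i"
    and sums: "(q has_sum 1) I" "((\<lambda>i. a i * q i) has_sum m) I" "((\<lambda>i. a i powr p * q i) has_sum s) I"
    and p: "1 \<le> p"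
  shows "m powr p \<le> s"
proof (cases "p = 1")
  case True
  have "0 \<le> m"
    by (rule has_sum_nonneg[OF sums(2)]) (simp add: nonneg)
  moreover have "((\<lambda>i. a i * q i) has_sum s) I"
    using sums(3) nonneg(1) True by (simp cong: has_sum_cong)
  ultimately show ?thesis
    using has_sum_unique[OF sums(2)] True by simp
next
  case False
  have s: "0 \<le> s"
    by (rule has_sum_nonneg[OF sums(3)]) (simp add: nonneg)
  have m: "0 \<le> m"
    by (rule has_sum_nonneg[OF sums(2)]) (simp add: nonneg)
  have "m \<le> s powr (1 / p) * 1 powr (1 - 1 / p)"
  proof (rule Holder_has_sum[OF _ _ sums(3,1,2)])
    fix i assume i: "i \<in> I"
    have "q i powr (1 / p) * q i powr (1 - 1 / p) = q i"
      using nonneg(2)[OF i] by (simp flip: powr_add)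
    moreover have "(a i powr p) powr (1 / p) = a i"
      using nonneg(1)[OF i] p by (simp add: powr_powr)
    ultimately show "a i * q i \<le> (a i powr p * q i) powr (1 / p) * q i powr (1 - 1 / p)"
      using nonneg[OF i] by (simp add: powr_mult mult.assoc)
  qed (use nonneg p False in auto)
  then have "m powr p \<le> (s powr (1 / p)) powr p"
    using m p by (intro powr_mono2) auto
  also have "\<dots> = s"
    using s p by (simp add: powr_powr)
  finally show ?thesis .
qed

lemma summable_on_sum:
  fixes f :: "'j \<Rightarrow> 'i \<Rightarrow> real"
  assumes "\<And>x. x \<in> X \<Longrightarrow> f x summable_on I"
  shows "(\<lambda>i. \<Sum>x\<in>X. f x i) summable_on I"
  using assms by (induction X rule: infinite_finite_induct) (auto intro: summable_on_add)

lemma has_sum_finite_superlevel: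
  fixes a :: "'i \<Rightarrow> real"
  assumes a: "(a has_sum c) I" "\<And>i. i \<in> I \<Longrightarrow> 0 \<le> a i" and d: "d > 0"
  shows "finite {i\<in>I. d < a i}"
proof (rule ccontr)
  assume "infinite {i\<in>I. d < a i}"
  \<comment> \<open>More than \<open>c / d\<close> terms above \<open>d\<close> would already exceed
    the total \<open>c\<close>.\<close>
  then obtain J where J: "finite J" "card J = nat \<lceil>c / d\<rceil> + 1" "J \<subseteq> {i\<in>I. d < a i}"
    using infinite_arbitrarily_large by blast
  have "c < d * card J"
  proof -
    have "c / d < real (nat \<lceil>c / d\<rceil> + 1)"
      by linarith
    with J(2) d show ?thesis
      by (simp add: field_simps)
  qed
  also have "d * card J \<le> sum a J"
    using sum_bounded_below[of J d a] J(3) by (force simp: mult.commute)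
  also have "sum a J \<le> c"
    using a(2) J by (intro finite_sum_le_has_sum[OF a(1)]) auto
  finally show False
    by simp
qed

section \<open>Trace inequalities\<close>

lemma diagonal_in_coefficient:
  assumes T: "diagonal_in B a T" and e: "e \<in> B"
  shows "a e = inner e (blinfun_apply T e)"
  using diagonal_in_eigenvector[OF assms] orthonormal_norm[OF orthonormal_basis_imp_orthonormal[OF diagonal_in_basis[OF T]] e]
  by (simp add: scaleC_of_real power2_norm_eq_inner[symmetric])

lemma diagonal_in_coefficient_le:
  assumes T: "diagonal_in B a T" and e: "e \<in> B"
  shows "a e \<le> norm T"
  using inner_blinfun_le[of e T] orthonormal_norm[OF orthonormal_basis_imp_orthonormal[OF diagonal_in_basis[OF T]] e]
  by (simp add: diagonal_in_coefficient[OF assms])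

text \<open>Jensen for the spectral measure of \<open>T\<close> at \<open>e\<close>.
  \<open>S\<close> is any operator with the right eigenvalues: \<open>op_powr T p\<close> in one
  use, a density operator as power of its own root in another.\<close>

lemma inner_powr_le_op_powr:
  assumes T: "diagonal_in B a T" and a: "\<And>f. f \<in> B \<Longrightarrow> 0 \<le> a f"
    and e: "norm e = 1" and p: "1 \<le> p" and S: "diagonal_in B (\<lambda>f. a f powr p) S"
  shows "inner e (blinfun_apply T e) powr p \<le> inner e (blinfun_apply S e)"
  using Parseval[OF diagonal_in_basis[OF T], of e] e
  by (intro Jensen_powr_has_sum[OF a _ _ diagonal_in_has_sum_inner[OF T] diagonal_in_has_sum_inner[OF S] p])
     auto

text \<open>\<open>trace_powr T p c\<close> says that \<open>Tr T\<^sup>p = c < \<infinity>\<close>.\<close>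

definition trace_powr :: "('a::complex_hilbert \<Rightarrow>\<^sub>L 'a) \<Rightarrow> real \<Rightarrow> real \<Rightarrow> bool"
  where "trace_powr T p c \<longleftrightarrow> (\<exists>B a. diagonal_in B a T \<and> (\<forall>e\<in>B. 0 \<le> a e) \<and>
    ((\<lambda>e. a e powr p) has_sum c) B)"

lemma trace_powr_op_powr:
  assumes "trace_powr T p c" "p > 0"
  shows "op_trace (op_powr T p) = of_real c"
proof -
  obtain B a where T: "diagonal_in B a T" and a: "\<And>e. e \<in> B \<Longrightarrow> 0 \<le> a e"
    and c: "((\<lambda>e. a e powr p) has_sum c) B"
    using assms(1) unfolding trace_powr_def by blast
  have "diagonal_in B (\<lambda>e. a e powr p) (op_powr T p)"
    using a diagonal_in_coefficient_le[OF T] by (intro op_powr_diagonal[OF T _ assms(2)]) auto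
  then show ?thesis
    by (rule op_trace_diagonal[OF _ _ c]) simp
qed

text \<open>\<open>g\<close> is the diagonal of \<open>op_powr T p\<close> in the basis
  \<open>E\<close>; its sum is the trace in whichever basis it is taken.\<close>

lemma trace_powr_dominates:
  assumes "trace_powr T p c" "1 \<le> p" and E: "orthonormal_basis E"
  obtains g where "(g has_sum c) E" "\<And>e. e \<in> E \<Longrightarrow> inner e (blinfun_apply T e) powr p \<le> g e"
proof -
  obtain B a where T: "diagonal_in B a T" and a: "\<And>e. e \<in> B \<Longrightarrow> 0 \<le> a e"
    and c: "((\<lambda>e. a e powr p) has_sum c) B"
    using assms(1) unfolding trace_powr_def by blast
  have S: "diagonal_in B (\<lambda>e. a e powr p) (op_powr T p)"
    using a diagonal_in_coefficient_le[OF T] assms(2) by (intro op_powr_diagonal[OF T]) auto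
  show ?thesis
  proof (rule that)
    show "((\<lambda>e. inner e (blinfun_apply (op_powr T p) e)) has_sum c) E"
      using has_sum_trace_iff[OF S _ E] c by simp
    show "inner e (blinfun_apply T e) powr p \<le> inner e (blinfun_apply (op_powr T p) e)" if "e \<in> E" for e
      by (rule inner_powr_le_op_powr[OF T a _ assms(2) S])
         (use orthonormal_norm[OF orthonormal_basis_imp_orthonormal[OF E] that] in auto)
  qed
qed

text \<open>All three operators are tested on an eigenbasis of \<open>T\<close>, where the powers of
  the diagonal entries sum exactly to \<open>c\<close>. In this basis \<open>T0\<close> and
  \<open>T1\<close> need not be diagonal, but Jensen errs in the favourable direction.\<close>

lemma trace_powr_interpolation:
  assumes tr: "trace_powr T p c" "trace_powr T0 p0 c0" "trace_powr T1 p1 c1"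
    and nonneg: "\<And>e. 0 \<le> inner e (blinfun_apply T0 e)" "\<And>e. 0 \<le> inner e (blinfun_apply T1 e)"
    and le: "\<And>e. inner e (blinfun_apply T e)
      \<le> inner e (blinfun_apply T0 e) powr l * inner e (blinfun_apply T1 e) powr (1 - l)"
    and p: "1 \<le> p0" "1 \<le> p1" "p = t * p0 + (1 - t) * p1" "l * p = t * p0"
    and t: "0 < t" "t < 1"
  shows "c \<le> c0 powr t * c1 powr (1 - t)"
proof -
  obtain E a where T: "diagonal_in E a T" and a: "\<And>e. e \<in> E \<Longrightarrow> 0 \<le> a e"
    and c: "((\<lambda>e. a e powr p) has_sum c) E"
    using tr(1) unfolding trace_powr_def by blast
  note E = diagonal_in_basis[OF T]
  obtain g0 where g0: "(g0 has_sum c0) E" "\<And>e. e \<in> E \<Longrightarrow> inner e (blinfun_apply T0 e) powr p0 \<le> g0 e"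
    using trace_powr_dominates[OF tr(2) p(1) E] by metis
  obtain g1 where g1: "(g1 has_sum c1) E" "\<And>e. e \<in> E \<Longrightarrow> inner e (blinfun_apply T1 e) powr p1 \<le> g1 e"
    using trace_powr_dominates[OF tr(3) p(2) E] by metis
  have p_pos: "p > 0"
    unfolding p(3) using p(1,2) t by (intro add_pos_pos mult_pos_pos) auto
  have l': "(1 - l) * p = (1 - t) * p1"
    using p(3,4) by (simp add: algebra_simps)
  show ?thesis
  proof (rule Holder_has_sum[OF _ _ g0(1) g1(1) c t])
    fix e assume e: "e \<in> E"
    let ?x = "inner e (blinfun_apply T0 e)" and ?y = "inner e (blinfun_apply T1 e)"
    show "0 \<le> g0 e" "0 \<le> g1 e"
      using g0(2)[OF e] g1(2)[OF e] by (meson order_trans powr_ge_zero)+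
    have "a e powr p \<le> (?x powr l * ?y powr (1 - l)) powr p"
      using le[of e] a[OF e] p_pos unfolding diagonal_in_coefficient[OF T e]
      by (intro powr_mono2) auto
    also have "\<dots> = (?x powr p0) powr t * (?y powr p1) powr (1 - t)"
      using p(4) l' by (simp add: powr_mult powr_powr mult.commute)
    also have "\<dots> \<le> g0 e powr t * g1 e powr (1 - t)"
      using g0(2)[OF e] g1(2)[OF e] t by (intro mult_mono powr_mono2) auto
    finally show "a e powr p \<le> g0 e powr t * g1 e powr (1 - t)" .
  qed
qed

section \<open>Mixtures of powers of density operators\<close>

text \<open>Each input has its own eigenbasis \<open>B x\<close>; no relation between these bases is
  imposed, since the density operators need not commute.\<close>

locale diagonalized_channel =
  fixes X :: "'x set" and q :: "'x \<Rightarrow> real" and W :: "'x \<Rightarrow> ('a::complex_hilbert \<Rightarrow>\<^sub>L 'a)"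
    and B :: "'x \<Rightarrow> 'a set" and w :: "'x \<Rightarrow> 'a \<Rightarrow> real"
  assumes X: "finite X" and q_nonneg: "\<And>x. x \<in> X \<Longrightarrow> 0 \<le> q x" and q_sum: "sum q X = 1"
    and W: "\<And>x. x \<in> X \<Longrightarrow> diagonal_in (B x) (w x) (W x)"
    and w_nonneg: "\<And>x f. x \<in> X \<Longrightarrow> f \<in> B x \<Longrightarrow> 0 \<le> w x f"
    and w_sum: "\<And>x. x \<in> X \<Longrightarrow> (w x has_sum 1) (B x)"
begin

definition mix :: "real \<Rightarrow> ('a \<Rightarrow>\<^sub>L 'a)"
  where "mix r = (\<Sum>x\<in>X. q x *\<^sub>R op_powr (W x) r)"

lemma W_powr: "x \<in> X \<Longrightarrow> 0 < r \<Longrightarrow> diagonal_in (B x) (\<lambda>f. w x f powr r) (op_powr (W x) r)"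
  using w_nonneg diagonal_in_coefficient_le[OF W] by (intro op_powr_diagonal[OF W]) auto

lemma inner_mix: "inner e (blinfun_apply (mix r) e) = (\<Sum>x\<in>X. q x * inner e (blinfun_apply (op_powr (W x) r) e))"
  by (simp add: mix_def blinfun.sum_left blinfun.scaleR_left inner_sum_right)

lemma W_powr_nonneg: "x \<in> X \<Longrightarrow> 0 < r \<Longrightarrow> 0 \<le> inner e (blinfun_apply (op_powr (W x) r) e)"
  by (rule positive_operator_inner_nonneg[OF diagonal_in_positive[OF W_powr]]) auto

lemma mix_positive: "0 < r \<Longrightarrow> positive_operator (mix r)"
  unfolding mix_def
  by (intro positive_operator_sum positive_operator_scaleR q_nonneg diagonal_in_positive[OF W_powr]) auto

text \<open>Summable eigenvalues exceed a positive threshold only finitely often, and a positive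
  power preserves this. Compactness then provides an eigenbasis of the mixture, which the bases
  \<open>B x\<close> do not give.\<close>

lemma mix_compact:
  assumes r: "0 < r"
  shows "compact_operator (mix r)"
  unfolding mix_def
proof (intro compact_operator_sum compact_operator_scaleR)
  fix x assume x: "x \<in> X"
  show "compact_operator (op_powr (W x) r)"
  proof (rule diagonal_in_compact[OF W_powr[OF x r]])
    fix d :: real
    assume d: "d > 0"
    have "d powr (1 / r) < w x f" if "f \<in> B x" "d < w x f powr r" for f
    proof -
      have "d powr (1 / r) < (w x f powr r) powr (1 / r)"
        using d r that(2) by (intro powr_less_mono2) auto
      then show ?thesis
        using w_nonneg[OF x that(1)] r by (simp add: powr_powr)
    qed
    then have "{f\<in>B x. d < \<bar>w x f powr r\<bar>} \<subseteq> {f\<in>B x. d powr (1 / r) < w x f}"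
      by auto
    moreover have "finite {f\<in>B x. d powr (1 / r) < w x f}"
      using d by (intro has_sum_finite_superlevel[OF w_sum[OF x] w_nonneg[OF x]]) auto
    ultimately show "finite {f\<in>B x. d < \<bar>w x f powr r\<bar>}"
      by (rule finite_subset)
  qed
qed

lemma inner_mix_interpolation:
  assumes r: "0 < r0" "0 < r1" "r = l * r0 + (1 - l) * r1" and l: "0 < l" "l < 1"
  shows "inner e (blinfun_apply (mix r) e)
    \<le> inner e (blinfun_apply (mix r0) e) powr l * inner e (blinfun_apply (mix r1) e) powr (1 - l)"
proof -
  let ?v = "\<lambda>r x. inner e (blinfun_apply (op_powr (W x) r) e)"
  have r_pos: "0 < r"
    unfolding r(3) using r(1,2) l by (intro add_pos_pos mult_pos_pos) auto
  have v: "?v r x \<le> ?v r0 x powr l * ?v r1 x powr (1 - l)" if x: "x \<in> X" for x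
  proof (rule Holder_has_sum[OF _ _ diagonal_in_has_sum_inner[OF W_powr[OF x r(1)]]
        diagonal_in_has_sum_inner[OF W_powr[OF x r(2)]] diagonal_in_has_sum_inner[OF W_powr[OF x r_pos]] l])
    fix f assume f: "f \<in> B x"
    let ?z = "(cmod (cinner f e))\<^sup>2"
    have "?z powr l * ?z powr (1 - l) = ?z"
      by (simp flip: powr_add)
    moreover have "(w x f powr r0) powr l * (w x f powr r1) powr (1 - l) = w x f powr r"
      unfolding powr_powr powr_add[symmetric] r(3) by (simp add: mult.commute)
    ultimately have "(w x f powr r0 * ?z) powr l * (w x f powr r1 * ?z) powr (1 - l) = w x f powr r * ?z"
      by (simp add: powr_mult mult_ac)
    then show "w x f powr r * ?z \<le> (w x f powr r0 * ?z) powr l * (w x f powr r1 * ?z) powr (1 - l)"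
      by simp
  qed auto
  have finite_has_sum: "((\<lambda>x. q x * ?v r x) has_sum inner e (blinfun_apply (mix r) e)) X" for r
    unfolding inner_mix using X by (intro has_sum_finite)
  show ?thesis
  proof (rule Holder_has_sum[OF _ _ finite_has_sum finite_has_sum finite_has_sum l])
    fix x assume x: "x \<in> X"
    have nn: "0 \<le> q x" "0 \<le> ?v r0 x" "0 \<le> ?v r1 x"
      using q_nonneg[OF x] W_powr_nonneg[OF x] r by auto
    then show "0 \<le> q x * ?v r0 x" "0 \<le> q x * ?v r1 x"
      by auto
    have "q x * ?v r x \<le> q x * (?v r0 x powr l * ?v r1 x powr (1 - l))"
      by (intro mult_left_mono v x nn)
    \<comment> \<open>The weight \<open>q x\<close> is split between the two factors so that Hoelder
      applies to the sum over inputs.\<close>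
    also have "\<dots> = (q x powr l * q x powr (1 - l)) * (?v r0 x powr l * ?v r1 x powr (1 - l))"
      using nn(1) by (simp flip: powr_add)
    also have "\<dots> = (q x * ?v r0 x) powr l * (q x * ?v r1 x) powr (1 - l)"
      using nn by (simp add: powr_mult)
    finally show "q x * ?v r x \<le> (q x * ?v r0 x) powr l * (q x * ?v r1 x) powr (1 - l)" .
  qed
qed

text \<open>Jensen over the inputs and then for each \<open>W x\<close> bounds
  \<open>a e powr p\<close> by the diagonal entry of the average density operator, whose diagonal is
  summable. Positivity is needed to take logarithms of products.\<close>

lemma mix_trace:
  assumes p: "1 \<le> p"
  obtains c where "trace_powr (mix (1 / p)) p c" "0 < c"
proof -
  have r: "0 < 1 / p"
    using p by simp
  obtain E a where E: "diagonal_in E a (mix (1 / p))" and a: "\<And>e. e \<in> E \<Longrightarrow> 0 \<le> a e"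
    using compact_positive_diagonalization[OF mix_positive[OF r] mix_compact[OF r]] by metis
  have le: "a e powr p \<le> (\<Sum>x\<in>X. q x * inner e (blinfun_apply (W x) e))" if e: "e \<in> E" for e
  proof -
    let ?v = "\<lambda>x. inner e (blinfun_apply (op_powr (W x) (1 / p)) e)"
    have norm_e: "norm e = 1"
      by (rule orthonormal_norm[OF orthonormal_basis_imp_orthonormal[OF diagonal_in_basis[OF E]] e])
    have "inner e (blinfun_apply (mix (1 / p)) e) powr p \<le> (\<Sum>x\<in>X. ?v x powr p * q x)"
    proof (rule Jensen_powr_has_sum[where a = ?v and q = q and I = X, OF _ q_nonneg _ _ _ p])
      show "(q has_sum 1) X"
        using X q_sum by (simp add: has_sum_finiteI)
      show "((\<lambda>x. ?v x * q x) has_sum inner e (blinfun_apply (mix (1 / p)) e)) X"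
        using X by (intro has_sum_finiteI) (auto simp: inner_mix mult.commute)
    qed (use X W_powr_nonneg r in \<open>auto intro: has_sum_finite\<close>)
    also have "\<dots> \<le> (\<Sum>x\<in>X. q x * inner e (blinfun_apply (W x) e))"
    proof (rule sum_mono)
      fix x assume x: "x \<in> X"
      \<comment> \<open>\<open>W x\<close> is the \<open>p\<close>-th power of its own root in the
        same basis, so it can serve as the operator \<open>S\<close> in Jensen's inequality.\<close>
      have "diagonal_in (B x) (\<lambda>f. (w x f powr (1 / p)) powr p) (W x)"
        using W[OF x] w_nonneg[OF x] p by (simp add: diagonal_in_def powr_powr)
      then have "?v x powr p \<le> inner e (blinfun_apply (W x) e)"
        by (intro inner_powr_le_op_powr[OF W_powr[OF x r] _ norm_e p]) auto
      then show "?v x powr p * q x \<le> q x * inner e (blinfun_apply (W x) e)"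
        using q_nonneg[OF x] by (simp add: mult.commute mult_left_mono)
    qed
    finally show ?thesis
      unfolding diagonal_in_coefficient[OF E e] .
  qed
  have "((\<lambda>e. \<Sum>x\<in>X. q x * inner e (blinfun_apply (W x) e)) summable_on E)"
  proof (rule summable_on_sum)
    fix x assume x: "x \<in> X"
    have "((\<lambda>e. inner e (blinfun_apply (W x) e)) has_sum 1) E"
      using has_sum_trace_iff[OF W[OF x] w_nonneg[OF x] diagonal_in_basis[OF E]] w_sum[OF x] by blast
    then show "(\<lambda>e. q x * inner e (blinfun_apply (W x) e)) summable_on E"
      by (intro summable_on_cmult_right) (auto simp: summable_on_def)
  qed
  then have "(\<lambda>e. a e powr p) summable_on E"
    by (rule summable_on_comparison_test) (use le in auto)
  then obtain c where c: "((\<lambda>e. a e powr p) has_sum c) E"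
    unfolding summable_on_def by blast
  have "0 \<le> c"
    by (rule has_sum_nonneg[OF c]) simp
  \<comment> \<open>A vanishing trace would make the mixture zero, hence also every
    \<open>W x\<close> with \<open>q x\<close> nonzero, against its trace being 1.\<close>
  moreover have "c \<noteq> 0"
  proof
    assume "c = 0"
    then have "a e = 0" if "e \<in> E" for e
      using nonneg_has_sum_le_0D[OF c _ _ that] by simp
    then have "mix (1 / p) = 0"
      using diagonal_in_unique[OF E, of 0] diagonal_in_basis[OF E] by (simp add: diagonal_in_def)
    then have zero: "(\<Sum>x\<in>X. q x * inner e (blinfun_apply (op_powr (W x) (1 / p)) e)) = 0" for e
      using inner_mix[of e "1 / p"] by simp
    obtain x where x: "x \<in> X" "q x \<noteq> 0"
      using q_sum by (metis sum.neutral zero_neq_one)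
    have "w x f = 0" if f: "f \<in> B x" for f
    proof -
      have "q x * inner f (blinfun_apply (op_powr (W x) (1 / p)) f) = 0"
        using zero[of f] x(1) sum_nonneg_eq_0_iff[OF X, of "\<lambda>x. q x * inner f (blinfun_apply (op_powr (W x) (1 / p)) f)"]
          q_nonneg W_powr_nonneg[OF _ r] by auto
      then have "w x f powr (1 / p) = 0"
        using x(2) diagonal_in_coefficient[OF W_powr[OF x(1) r] f] by simp
      then show ?thesis
        by simp
    qed
    then have "(w x has_sum 0) (B x)"
      by (intro has_sum_0)
    then show False
      using has_sum_unique[OF w_sum[OF x(1)]] by force
  qed
  ultimately show ?thesis
    using that E a c unfolding trace_powr_def by force
qed

end

section \<open>Concavity from log-convexity of the trace in \<open>p = 1 + s\<close>\<close>

theorem theorem7: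
  fixes W :: "nat \<Rightarrow> ('h::complex_hilbert \<Rightarrow>\<^sub>L 'h)"
    and P :: "nat pmf" and N :: nat and b :: real
  assumes "separable_space (euclidean :: 'h topology)"
    and "b > 1"
    and "cq_channel {1..N} W"
    and "set_pmf P \<subseteq> {1..N}"
  shows "concave_on {0..} (\<lambda>s. auxiliary_function b {1..N} W s P)"
proof -
  have "\<forall>x\<in>{1..N}. \<exists>B w. diagonal_in B w (W x) \<and> (\<forall>f\<in>B. 0 \<le> w f) \<and> (w has_sum 1) B"
    using assms(3) density_operator_diagonalization unfolding cq_channel_def by metis
  then obtain B w where "\<forall>x\<in>{1..N}. diagonal_in (B x) (w x) (W x) \<and> (\<forall>f\<in>B x. 0 \<le> w x f) \<and> (w x has_sum 1) (B x)"
    by metis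
  then interpret diagonalized_channel "{1..N}" "pmf P" W B w
    using assms(4) by unfold_locales (auto simp: sum_pmf_eq_1)
  have "\<exists>c. trace_powr (mix (1 / p)) p c \<and> 0 < c" if "1 \<le> p" for p
    using mix_trace[OF that] by metis
  then obtain c where c: "\<And>p. 1 \<le> p \<Longrightarrow> trace_powr (mix (1 / p)) p (c p)" "\<And>p. 1 \<le> p \<Longrightarrow> 0 < c p"
    by metis
  have aux: "auxiliary_function b {1..N} W s P = - log b (c (1 + s))" if "s \<in> {0..}" for s
    using trace_powr_op_powr[OF c(1)[of "1 + s"]] that
    unfolding auxiliary_function_def mix_def[symmetric] by simp
  have "convex_on {0..} (\<lambda>s. - auxiliary_function b {1..N} W s P)"
  proof (rule convex_onI)
    \<comment> \<open>\<open>convex_onI\<close> gives the weight \<open>1 - t\<close> to its first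
      point, so \<open>t\<close> belongs to \<open>s0\<close>.\<close>
    fix t s1 s0 :: real
    assume t: "0 < t" "t < 1" and s: "s1 \<in> {0..}" "s0 \<in> {0..}"
    \<comment> \<open>\<open>l\<close> is the share of \<open>t * p0\<close> in \<open>p\<close>;
      with it \<open>1 / p\<close> is the mean of \<open>1 / p0\<close> and \<open>1 / p1\<close>
      with weights \<open>l\<close> and \<open>1 - l\<close>.\<close>
    define p0 p1 p l where "p0 = 1 + s0" and "p1 = 1 + s1" and "p = t * p0 + (1 - t) * p1"
      and "l = t * p0 / p"
    have p01: "1 \<le> p0" "1 \<le> p1"
      using s by (auto simp: p0_def p1_def)
    have p: "p = 1 + ((1 - t) *\<^sub>R s1 + t *\<^sub>R s0)"
      by (simp add: p_def p0_def p1_def algebra_simps)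
    have s01: "(1 - t) *\<^sub>R s1 + t *\<^sub>R s0 \<in> {0..}"
      using s t by simp
    then have p_ge: "1 \<le> p"
      unfolding p by simp
    have l: "0 < l" "l < 1" "l * p = t * p0"
      using t p01 p_ge by (auto simp: l_def p_def)
    have "1 / p = l * (1 / p0) + (1 - l) * (1 / p1)"
    proof -
      have "(1 - l) * p = (1 - t) * p1"
        using l(3) by (simp add: p_def algebra_simps)
      then have "1 - l = (1 - t) * p1 / p"
        using p_ge by (simp add: field_simps)
      then show ?thesis
        using p01 p_ge by (simp add: l_def field_simps)
    qed
    then have "c p \<le> c p0 powr t * c p1 powr (1 - t)"
      using p01 p_ge t l
      by (intro trace_powr_interpolation[OF c(1) c(1) c(1), of p p0 p1 l t] inner_mix_interpolation
          positive_operator_inner_nonneg mix_positive) (auto simp: p_def)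
    then have "log b (c p) \<le> log b (c p0 powr t * c p1 powr (1 - t))"
      using assms(2) c(2)[OF p_ge] by (intro log_mono) auto
    also have "\<dots> = t * log b (c p0) + (1 - t) * log b (c p1)"
      using assms(2) c(2)[OF p01(1)] c(2)[OF p01(2)] by (simp add: log_mult log_powr)
    finally show "- auxiliary_function b {1..N} W ((1 - t) *\<^sub>R s1 + t *\<^sub>R s0) P
        \<le> (1 - t) * (- auxiliary_function b {1..N} W s1 P) + t * (- auxiliary_function b {1..N} W s0 P)"
      unfolding aux[OF s01] aux[OF s(1)] aux[OF s(2)] p[symmetric] by (simp add: p0_def p1_def)
  qed simp
  then show ?thesis
    by (simp add: concave_on_def)
qed

end
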